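(* Let $\alpha\in\mathbb{S}_m$. Then $\Phi\big(w_{\mathfrak{gl}}(\alpha^{-1})\big)=(-1)^m\,\Phi\big(w_{\mathfrak{gl}}(\alpha)\big)\big|_{S_i\mapsto(-1)^iS_i,\ i=1,2,\dots}$, where $\Phi$ is the Schur substitution.
   Context: For $N\ge1$ and $\alpha\in\mathbb{S}_m$, $w_{\mathfrak{gl}(N)}(\alpha)=\sum_{i_1,\dots,i_m=1}^N E_{i_1i_{\alpha(1)}}\cdots E_{i_mi_{\alpha(m)}}\in ZU(\mathfrak{gl}(N))$, $E_{ij}$ the matrix units; $C_k^{(N)}=w_{\mathfrak{gl}(N)}((1,\dots,k))$. The universal $\mathfrak{gl}$-weight system $w_{\mathfrak{gl}}:\bigsqcup_m\mathbb{S}_m\to\mathbb{C}[N,C_1,C_2,\dots]$ is the unique function such that for every $N\ge1$ the specialization $C_k\mapsto C_k^{(N)}$ sends $w_{\mathfrak{gl}}(\alpha)$ to $w_{\mathfrak{gl}(N)}(\alpha)$. The Schur substitution is the $\mathbb{C}[N]$-algebra isomorphism $\Phi:\mathbb{C}[N][C_1,C_2,\dots]\to\mathbb{C}[N][S_1,S_2,\dots]$ determined by the identity of formal power series in $u$: $1-Nu-\sum_{k\ge1}\Phi(C_k)u^{k+1}=\left(\frac{1-(N+1)u/2}{1-(N-1)u/2}\right)^N\frac{1+\sum_{i\ge1}S_i\big(\frac{u}{1-(N-1)u/2}\big)^i}{1+\sum_{i\ge1}S_i\big(\frac{u}{1-(N+1)u/2}\big)^i}$; e.g. $\Phi(C_1)=S_1$,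 $\Phi(C_2)=2S_2-S_1^2-\tfrac1{12}(N-1)N(N+1)$. (Under the Harish-Chandra isomorphism, $S_k$ corresponds to the complete homogeneous symmetric function of degree $k$ in $x_i=E_{ii}+\frac{N+1}{2}-i$.) *)

theory Defs
  imports "HOL-Library.Poly_Mapping" "HOL-Library.FuncSet"
    "HOL-Computational_Algebra.Formal_Power_Series" "HOL-Combinatorics.Permutations"
begin

text \<open>A polynomial over the complex numbers in the variables X_0, X_1, X_2, ...
  Monomials are finitely supported exponent vectors.  In the source ring
  C[N,C_1,C_2,...] the variable X_0 is N and X_k (k >= 1) is C_k; in the target
  ring C[N,S_1,S_2,...] the variable X_0 is N and X_k (k >= 1) is S_k.\<close>

type_synonym mpoly = "(nat \<Rightarrow>\<^sub>0 nat) \<Rightarrow>\<^sub>0 complex"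

definition pvar :: "nat \<Rightarrow> mpoly" where
  "pvar v = Poly_Mapping.single (Poly_Mapping.single v 1) 1"

definition pconst :: "complex \<Rightarrow> mpoly" where
  "pconst c = Poly_Mapping.single 0 c"

definition psubst :: "(nat \<Rightarrow> mpoly) \<Rightarrow> mpoly \<Rightarrow> mpoly" where
  "psubst img p = (\<Sum>mo\<in>Poly_Mapping.keys p.
      pconst (Poly_Mapping.lookup p mo) *
      (\<Prod>v\<in>Poly_Mapping.keys mo. img v ^ Poly_Mapping.lookup mo v))"

abbreviation pN :: mpoly where "pN \<equiv> pvar 0"

text \<open>y = u/(1-(N-1)u/2) as a formal power series in u over C[N,S].\<close>
definition schur_y :: "mpoly fps" where
  "schur_y = Abs_fps (\<lambda>k. if k = 0 then 0 else ((pN - 1) * pconst (1/2)) ^ (k - 1))"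

text \<open>z = u/(1-(N+1)u/2).\<close>
definition schur_z :: "mpoly fps" where
  "schur_z = Abs_fps (\<lambda>k. if k = 0 then 0 else ((pN + 1) * pconst (1/2)) ^ (k - 1))"

definition binomN :: "nat \<Rightarrow> mpoly" where
  "binomN k = pconst (1 / fact k) * (\<Prod>j<k. pN - of_nat j)"

text \<open>((1-(N+1)u/2)/(1-(N-1)u/2))^N = (1 - y)^N with formal exponent N,
  i.e. the binomial series sum_k binom(N,k) (-y)^k (well defined since y has order 1).\<close>
definition schur_R :: "mpoly fps" where
  "schur_R = Abs_fps (\<lambda>n. \<Sum>k\<le>n. binomN k * fps_nth ((- schur_y) ^ k) n)"

text \<open>1 + sum_{i>=1} S_i w^i for a series w of order >= 1.\<close>
definition schur_D :: "mpoly fps \<Rightarrow> mpoly fps" where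
  "schur_D w = Abs_fps (\<lambda>n. if n = 0 then 1 else (\<Sum>i=1..n. pvar i * fps_nth (w ^ i) n))"

text \<open>The images c k = Phi(C_k), k >= 1 (normalized by c 0 = 0), determined by
  (1 - N u - sum_{k>=1} Phi(C_k) u^(k+1)) * D(z) = R * D(y).\<close>
definition schur_C :: "nat \<Rightarrow> mpoly" where
  "schur_C = (THE c. c 0 = 0 \<and>
      Abs_fps (\<lambda>n. if n = 0 then 1 else if n = 1 then - pN else - c (n - 1))
        * schur_D schur_z = schur_R * schur_D schur_y)"

definition schur_subst :: "mpoly \<Rightarrow> mpoly" where
  "schur_subst = psubst (\<lambda>v. if v = 0 then pN else schur_C v)"

definition sign_flip :: "mpoly \<Rightarrow> mpoly" where
  "sign_flip = psubst (\<lambda>v. if v = 0 then pN else (-1) ^ v * pvar v)"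

text \<open>Free associative C-algebra on generators E_(i,j): elements are coefficient
  functions on words (only finitely supported ones arise below).\<close>
type_synonym falg = "(nat \<times> nat) list \<Rightarrow> complex"

definition fmono :: "(nat \<times> nat) list \<Rightarrow> falg" where
  "fmono w = (\<lambda>v. if v = w then 1 else 0)"

definition fadd :: "falg \<Rightarrow> falg \<Rightarrow> falg" where
  "fadd a b = (\<lambda>w. a w + b w)"

definition fsmult :: "complex \<Rightarrow> falg \<Rightarrow> falg" where
  "fsmult c a = (\<lambda>w. c * a w)"

definition fmul :: "falg \<Rightarrow> falg \<Rightarrow> falg" where
  "fmul a b = (\<lambda>w. \<Sum>k\<le>length w. a (take k w) * b (drop k w))"

definition fsum :: "('i \<Rightarrow> falg) \<Rightarrow> 'i set \<Rightarrow> falg" where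
  "fsum f A = (\<lambda>w. \<Sum>i\<in>A. f i w)"

definition fpow :: "falg \<Rightarrow> nat \<Rightarrow> falg" where
  "fpow a n = ((fmul a) ^^ n) (fmono [])"

definition fE :: "nat \<Rightarrow> nat \<Rightarrow> falg" where
  "fE i j = fmono [(i, j)]"

definition gl_rel :: "nat \<Rightarrow> nat \<Rightarrow> nat \<Rightarrow> nat \<Rightarrow> falg" where
  "gl_rel i j k l =
     fadd (fadd (fmul (fE i j) (fE k l)) (fsmult (-1) (fmul (fE k l) (fE i j))))
          (fadd (fsmult (if j = k then -1 else 0) (fE i l))
                (fsmult (if l = i then 1 else 0) (fE k j)))"

text \<open>Two-sided ideal of the free algebra generated by the relations of gl(N)
  (matrix units E_ij with i,j < N); U(gl(N)) is the quotient by it.\<close>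
inductive_set gl_ideal :: "nat \<Rightarrow> falg set" for N :: nat where
  zero: "(\<lambda>_. 0) \<in> gl_ideal N"
| add: "a \<in> gl_ideal N \<Longrightarrow> b \<in> gl_ideal N \<Longrightarrow> fadd a b \<in> gl_ideal N"
| gen: "i < N \<Longrightarrow> j < N \<Longrightarrow> k < N \<Longrightarrow> l < N \<Longrightarrow>
        fsmult c (fmul (fmono u) (fmul (gl_rel i j k l) (fmono v))) \<in> gl_ideal N"

definition U_eq :: "nat \<Rightarrow> falg \<Rightarrow> falg \<Rightarrow> bool" where
  "U_eq N a b \<longleftrightarrow> fadd a (fsmult (-1) b) \<in> gl_ideal N"

text \<open>Permutations of S_m act on {0..<m}; matrix indices range over {0..<N}.
  w_gl(N)(alpha) = sum_{i} E_{i_1 i_alpha(1)} ... E_{i_m i_alpha(m)}.\<close>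
definition w_glN :: "nat \<Rightarrow> nat \<Rightarrow> (nat \<Rightarrow> nat) \<Rightarrow> falg" where
  "w_glN N m \<alpha> = fsum (\<lambda>i. fmono (map (\<lambda>s. (i s, i (\<alpha> s))) [0..<m]))
                       ({0..<m} \<rightarrow>\<^sub>E {0..<N})"

definition long_cycle :: "nat \<Rightarrow> nat \<Rightarrow> nat" where
  "long_cycle k = (\<lambda>s. if s < k then (s + 1) mod k else s)"

definition Casimir :: "nat \<Rightarrow> nat \<Rightarrow> falg" where
  "Casimir N k = w_glN N k (long_cycle k)"

text \<open>Specialisation N |-> N, C_k |-> C_k^(N) of a polynomial in C[N,C_1,C_2,...]
  (X_0 = N, X_k = C_k).  The Casimirs are central, so the order of the factors in a
  monomial is immaterial in U(gl(N)); we use increasing order of k.\<close>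
definition specialize :: "nat \<Rightarrow> mpoly \<Rightarrow> falg" where
  "specialize N p = fsum (\<lambda>mo. fsmult (Poly_Mapping.lookup p mo * of_nat N ^ Poly_Mapping.lookup mo 0)
        (foldr (\<lambda>k acc. fmul (fpow (Casimir N k) (Poly_Mapping.lookup mo k)) acc)
               (sorted_list_of_set (Poly_Mapping.keys mo - {0})) (fmono [])))
      (Poly_Mapping.keys p)"

definition w_gl :: "nat \<Rightarrow> (nat \<Rightarrow> nat) \<Rightarrow> mpoly" where
  "w_gl m \<alpha> = (THE p. \<forall>N\<ge>1. U_eq N (specialize N p) (w_glN N m \<alpha>))"

end

theory Submission
  imports Defs "HOL-Computational_Algebra.Polynomial"
begin

text \<open>The map E_ij \<mapsto> - E_ji is an automorphism of gl(N), and it sends w_gl(N)(\<alpha>) to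
  (-1)^m w_gl(N)(\<alpha>^-1).  Commuting the generators past the powers of the transposed matrix shows
  that it acts on the Casimir elements by A(u) \<mapsto> 1 / A(- u / (1 - N u)), where
  A(u) = 1 - N u - C_1 u^2 - C_2 u^3 - ....  The substitution u \<mapsto> - u / (1 - N u) sends
  y = u / (1 - (N-1) u / 2) to - z and z = u / (1 - (N+1) u / 2) to - y, and inverts (1 - y)^N;
  so under the Schur substitution this action becomes S_i \<mapsto> (-1)^i S_i.

  That the polynomial w_gl(\<alpha>) exists follows by sorting the letters of a permutation word into
  cycles, each commutator producing shorter permutation words.  It is unique because a polynomial
  relation between Casimir elements, valid for all N, would by passage to top symbols be a relation
  between the power sums of N complex numbers, and the first r power sums can be prescribed
  arbitrarily once N is large.\<close>

section \<open>The free algebra as a ring of finitely supported functions\<close>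

text \<open>Behind the sign: through Harish-Chandra the automorphism passes from a highest weight
  module to its dual, which negates the shifted weights x_i and reverses their order, so a symmetric
  function homogeneous of degree i is multiplied by (-1)^i. The proof does not take this route,
  since N is an indeterminate in the claim and no finite list of weights x_i is then available. It
  works on two levels instead: congruences modulo the relations of gl(N) for each numerical N, and
  identities of power series over C[N,S] for formal N. Uniqueness is the bridge: congruences valid
  for all N >= 1 lift to an equation in C[N,C_1,...], to which the Schur substitution can be
  applied. Both \<open>w_gl\<close> and \<open>schur_C\<close> are definite descriptions, so
  existence and uniqueness have to precede any statement about their values. Casimir elements
  commute only up to congruence, which is why their products carry an explicit order of
  factors.\<close>

instantiation list :: (type) monoid_add
begin
definition zero_list :: "'a list" where "zero_list = []"
definition plus_list :: "'a list \<Rightarrow> 'a list \<Rightarrow> 'a list" where "plus_list = (@)"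
instance by standard (auto simp: zero_list_def plus_list_def)
end

text \<open>Convolution over the free monoid of words is the product of the free algebra, so the
  ring laws come from the type class instead of being proved for \<open>fmul\<close>. Finite support
  is built into the type; the empty word is the index \<open>0\<close>, whence
  \<open>scal\<close>.\<close>

type_synonym nca = "(nat \<times> nat) list \<Rightarrow>\<^sub>0 complex"

abbreviation scal :: "complex \<Rightarrow> nca" where "scal c \<equiv> Poly_Mapping.single 0 c"
abbreviation word :: "(nat \<times> nat) list \<Rightarrow> nca" where "word w \<equiv> Poly_Mapping.single w 1"
abbreviation EE :: "nat \<Rightarrow> nat \<Rightarrow> nca" where "EE i j \<equiv> word [(i, j)]"

lemma poly_mapping_induct_single [case_names zero single add]:
  assumes "P 0" "\<And>k c. P (Poly_Mapping.single k c)" "\<And>a b. P a \<Longrightarrow> P b \<Longrightarrow> P (a + b)"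
  shows "P (p :: 'a \<Rightarrow>\<^sub>0 'b::comm_monoid_add)"
proof (induction p rule: update_induct)
  case const
  show ?case by (fact assms(1))
next
  case (update f a b)
  have "Poly_Mapping.update a b f = f + Poly_Mapping.single a b"
    using update.hyps
    by (intro poly_mapping_eqI) (auto simp: lookup_update lookup_add lookup_single in_keys_iff when_def)
  with update.IH assms show ?case by simp
qed

lemma scal_commute: "scal c * a = a * scal c"
proof (induction a rule: poly_mapping_induct_single)
  case (single k d)
  show ?case by (simp add: mult_single mult.commute)
qed (simp_all add: distrib_left distrib_right)

lemma scal_mult: "scal (c * d) = scal c * scal d"
  by (simp add: mult_single)

lemma scal_1 [simp]: "scal 1 = 1"
  by (simp add: single_one)

lemma lookup_scal_mult: "Poly_Mapping.lookup (scal c * a) w = c * Poly_Mapping.lookup a w"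
  by (induction a rule: poly_mapping_induct_single)
     (auto simp: mult_single lookup_single when_def distrib_left lookup_add)

text \<open>Among all cuts of a word only the one at \<open>length u\<close> can match both factors,
  so the sum in \<open>fmul\<close> collapses.\<close>

lemma fmul_fmono: "fmul (\<lambda>x. a * fmono u x) (\<lambda>x. b * fmono v x) = (\<lambda>x. a * b * fmono (u @ v) x)"
proof
  fix w
  have *: "(a * fmono u (take k w)) * (b * fmono v (drop k w)) =
        (if k = length u then a * b * fmono (u @ v) w else 0)" if "k \<le> length w" for k
  proof -
    have iff: "take k w = u \<and> drop k w = v \<longleftrightarrow> w = u @ v \<and> k = length u"
      using that by (auto simp: append_eq_conv_conj) 
    have "fmono u (take k w) * fmono v (drop k w) = (if take k w = u \<and> drop k w = v then 1 else 0)"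
      by (simp add: fmono_def)
    then have *: "fmono u (take k w) * fmono v (drop k w) = (if w = u @ v \<and> k = length u then 1 else 0)"
      unfolding iff .
    have "(a * fmono u (take k w)) * (b * fmono v (drop k w)) =
        a * b * (fmono u (take k w) * fmono v (drop k w))"
      by (simp only: mult_ac)
    also note *
    finally show ?thesis by (simp only:) (simp add: fmono_def)
  qed
  show "fmul (\<lambda>x. a * fmono u x) (\<lambda>x. b * fmono v x) w = a * b * fmono (u @ v) w"
    unfolding fmul_def using * by (auto simp: fmono_def)
qed

lemma lookup_single_fmono: "Poly_Mapping.lookup (Poly_Mapping.single w c) = (\<lambda>x. c * fmono w x)"
  by (auto simp: lookup_single fmono_def when_def)

lemma lookup_nca_mult: "Poly_Mapping.lookup ((a::nca) * b) = fmul (Poly_Mapping.lookup a) (Poly_Mapping.lookup b)"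
proof (induction a rule: poly_mapping_induct_single)
  case zero
  show ?case by (simp add: fmul_def fun_eq_iff)
next
  case (single u c)
  show ?case
  proof (induction b rule: poly_mapping_induct_single)
    case zero
    show ?case by (simp add: fmul_def fun_eq_iff)
  next
    case (single v d)
    show ?case
      unfolding mult_single lookup_single_fmono fmul_fmono by (simp add: plus_list_def)
  next
    case (add a b)
    then show ?case
      by (simp add: distrib_left fmul_def fun_eq_iff lookup_add sum.distrib)
  qed
next
  case (add a b)
  then show ?case
    by (simp add: distrib_right fmul_def fun_eq_iff lookup_add sum.distrib)
qed

lemma lookup_word: "Poly_Mapping.lookup (word w) = fmono w"
  by (simp add: lookup_single_fmono)

lemma lookup_nca_one: "Poly_Mapping.lookup (1::nca) = fmono []"
  by (simp add: fun_eq_iff lookup_one fmono_def zero_list_def when_def)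

lemma lookup_nca_add: "Poly_Mapping.lookup ((a::nca) + b) = fadd (Poly_Mapping.lookup a) (Poly_Mapping.lookup b)"
  by (simp add: fun_eq_iff fadd_def lookup_add)

lemma lookup_nca_scal: "Poly_Mapping.lookup (scal c * a) = fsmult c (Poly_Mapping.lookup a)"
  by (simp add: fun_eq_iff fsmult_def lookup_scal_mult)

lemma lookup_nca_sum: "Poly_Mapping.lookup (sum f A :: nca) = fsum (\<lambda>i. Poly_Mapping.lookup (f i)) A"
  by (simp add: fun_eq_iff fsum_def lookup_sum)

lemma lookup_nca_power: "Poly_Mapping.lookup ((a::nca) ^ n) = fpow (Poly_Mapping.lookup a) n"
  by (induction n) (simp_all add: fpow_def lookup_nca_one lookup_nca_mult)

lemma word_append: "word (u @ v) = word u * word v"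
  by (simp add: mult_single plus_list_def)

lemma word_Cons: "word ((i, j) # v) = EE i j * word v"
  using word_append[of "[(i, j)]" v] by simp

lemma word_Nil: "word [] = 1"
  unfolding zero_list_def[symmetric] by simp

lemma single_eq_scal_word: "Poly_Mapping.single w c = scal c * word w"
  by (simp add: mult_single)


section \<open>Congruence modulo the defining relations of gl(N)\<close>

definition rel_elt :: "nat \<Rightarrow> nat \<Rightarrow> nat \<Rightarrow> nat \<Rightarrow> nca" where
  "rel_elt i j k l = EE i j * EE k l - EE k l * EE i j
     - (if j = k then EE i l else 0) + (if l = i then EE k j else 0)"

text \<open>Multiplying the relations by words is enough for a two-sided ideal: arbitrary factors
  are linear combinations of words (\<open>rel_ideal_mult_left\<close>,
  \<open>rel_ideal_mult_right\<close>).\<close>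

inductive_set rel_ideal :: "nat \<Rightarrow> nca set" for N :: nat where
  zero: "0 \<in> rel_ideal N"
| add: "a \<in> rel_ideal N \<Longrightarrow> b \<in> rel_ideal N \<Longrightarrow> a + b \<in> rel_ideal N"
| gen: "i < N \<Longrightarrow> j < N \<Longrightarrow> k < N \<Longrightarrow> l < N \<Longrightarrow>
        scal c * (word u * (rel_elt i j k l * word v)) \<in> rel_ideal N"

lemma lookup_rel_elt: "Poly_Mapping.lookup (rel_elt i j k l) = gl_rel i j k l"
  by (auto simp: rel_elt_def gl_rel_def fun_eq_iff fadd_def fsmult_def lookup_add lookup_minus
      lookup_nca_mult lookup_word fE_def)

lemma rel_ideal_imp_gl_ideal:
  assumes "a \<in> rel_ideal N"
  shows "Poly_Mapping.lookup a \<in> gl_ideal N"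
  using assms
proof induction
  case zero
  have "Poly_Mapping.lookup (0::nca) = (\<lambda>_. 0)" by (simp add: fun_eq_iff)
  then show ?case using gl_ideal.zero by metis
next
  case (add a b)
  then show ?case by (simp add: lookup_nca_add gl_ideal.add)
next
  case (gen i j k l c u v)
  then show ?case
    by (simp only: lookup_nca_scal) (simp add: lookup_nca_mult lookup_word lookup_rel_elt gl_ideal.gen)
qed

text \<open>Members of \<open>gl_ideal\<close> are bare functions; the induction also recovers their
  finite support.\<close>

lemma gl_ideal_imp_rel_ideal:
  assumes "f \<in> gl_ideal N"
  shows "\<exists>a\<in>rel_ideal N. f = Poly_Mapping.lookup a"
  using assms
proof induction
  case zero
  have "Poly_Mapping.lookup (0::nca) = (\<lambda>_. 0)" by (simp add: fun_eq_iff)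
  then show ?case using rel_ideal.zero by metis
next
  case (add a b)
  then show ?case by (metis lookup_nca_add rel_ideal.add)
next
  case (gen i j k l c u v)
  then show ?case
    by (intro bexI[OF _ rel_ideal.gen[of i N j k l c u v]])
       (simp only: lookup_nca_scal, simp_all add: lookup_nca_mult lookup_word lookup_rel_elt)
qed

definition gl_cong :: "nca \<Rightarrow> nat \<Rightarrow> nca \<Rightarrow> bool" (\<open>(_ /\<approx>\<^bsub>_\<^esub> _)\<close> [51, 0, 51] 50) where
  "a \<approx>\<^bsub>N\<^esub> b \<longleftrightarrow> a - b \<in> rel_ideal N"

lemma U_eq_iff: "U_eq N (Poly_Mapping.lookup a) (Poly_Mapping.lookup b) \<longleftrightarrow> a \<approx>\<^bsub>N\<^esub> b"
proof -
  have "fadd (Poly_Mapping.lookup a) (fsmult (-1) (Poly_Mapping.lookup b)) = Poly_Mapping.lookup (a - b)"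
    by (simp add: fadd_def fsmult_def lookup_minus fun_eq_iff)
  then show ?thesis
    unfolding U_eq_def gl_cong_def
    by (metis gl_ideal_imp_rel_ideal rel_ideal_imp_gl_ideal poly_mapping_eq_iff)
qed

lemma rel_ideal_scal: "a \<in> rel_ideal N \<Longrightarrow> scal c * a \<in> rel_ideal N"
proof (induction rule: rel_ideal.induct)
  case (gen i j k l d u v)
  then show ?case
    using rel_ideal.gen[of i N j k l "c * d" u v] by (simp add: scal_mult mult.assoc)
qed (simp_all add: rel_ideal.zero rel_ideal.add distrib_left)

lemma rel_ideal_uminus: "a \<in> rel_ideal N \<Longrightarrow> - a \<in> rel_ideal N"
  using rel_ideal_scal[of a N "-1"] by (simp add: single_uminus)

lemma rel_ideal_diff: "a \<in> rel_ideal N \<Longrightarrow> b \<in> rel_ideal N \<Longrightarrow> a - b \<in> rel_ideal N"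
  using rel_ideal.add[OF _ rel_ideal_uminus, of a N b] by simp

lemma rel_ideal_word_mult: "a \<in> rel_ideal N \<Longrightarrow> word w * a \<in> rel_ideal N"
proof (induction rule: rel_ideal.induct)
  case (gen i j k l c u v)
  have "word w * (scal c * (word u * (rel_elt i j k l * word v))) =
      scal c * (word (w @ u) * (rel_elt i j k l * word v))"
    unfolding word_append by (simp only: mult.assoc[symmetric] scal_commute[of c "word w"])
  then show ?case using rel_ideal.gen[OF gen] by simp
qed (simp_all add: rel_ideal.zero rel_ideal.add distrib_left)

lemma rel_ideal_mult_word: "a \<in> rel_ideal N \<Longrightarrow> a * word w \<in> rel_ideal N"
proof (induction rule: rel_ideal.induct)
  case (gen i j k l c u v)
  then show ?case
    using rel_ideal.gen[of i N j k l c u "v @ w"] by (simp add: word_append mult.assoc)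
qed (simp_all add: rel_ideal.zero rel_ideal.add distrib_right)

lemma rel_ideal_mult_left: "a \<in> rel_ideal N \<Longrightarrow> b * a \<in> rel_ideal N"
proof (induction b rule: poly_mapping_induct_single)
  case (single w c)
  then show ?case
    unfolding single_eq_scal_word[of w c] mult.assoc by (intro rel_ideal_scal rel_ideal_word_mult)
qed (simp_all add: rel_ideal.zero rel_ideal.add distrib_right)

lemma rel_ideal_mult_right: "a \<in> rel_ideal N \<Longrightarrow> a * b \<in> rel_ideal N"
proof (induction b rule: poly_mapping_induct_single)
  case (single w c)
  have "a * Poly_Mapping.single w c = scal c * (a * word w)"
    by (simp only: single_eq_scal_word[of w c] mult.assoc[symmetric] scal_commute[of c a])
  with single show ?case by (simp only: rel_ideal_scal rel_ideal_mult_word)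
qed (simp_all add: rel_ideal.zero rel_ideal.add distrib_left)

lemma gl_cong_refl [simp, intro]: "a \<approx>\<^bsub>N\<^esub> a"
  by (simp add: gl_cong_def rel_ideal.zero)

lemma gl_cong_sym: "a \<approx>\<^bsub>N\<^esub> b \<Longrightarrow> b \<approx>\<^bsub>N\<^esub> a"
  using rel_ideal_uminus[of "a - b" N] by (simp add: gl_cong_def)

lemma gl_cong_trans [trans]: "a \<approx>\<^bsub>N\<^esub> b \<Longrightarrow> b \<approx>\<^bsub>N\<^esub> c \<Longrightarrow> a \<approx>\<^bsub>N\<^esub> c"
  using rel_ideal.add[of "a - b" N "b - c"] by (simp add: gl_cong_def)

lemma gl_cong_eq_trans [trans]: "a \<approx>\<^bsub>N\<^esub> b \<Longrightarrow> b = c \<Longrightarrow> a \<approx>\<^bsub>N\<^esub> c"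
  and eq_gl_cong_trans [trans]: "a = b \<Longrightarrow> b \<approx>\<^bsub>N\<^esub> c \<Longrightarrow> a \<approx>\<^bsub>N\<^esub> c"
  by simp_all

lemma gl_cong_add: "a \<approx>\<^bsub>N\<^esub> b \<Longrightarrow> c \<approx>\<^bsub>N\<^esub> d \<Longrightarrow> a + c \<approx>\<^bsub>N\<^esub> b + d"
  using rel_ideal.add[of "a - b" N "c - d"] by (simp add: gl_cong_def algebra_simps)

lemma gl_cong_diff: "a \<approx>\<^bsub>N\<^esub> b \<Longrightarrow> c \<approx>\<^bsub>N\<^esub> d \<Longrightarrow> a - c \<approx>\<^bsub>N\<^esub> b - d"
  using rel_ideal_diff[of "a - b" N "c - d"] by (simp add: gl_cong_def algebra_simps)

lemma gl_cong_mult: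
  assumes "a \<approx>\<^bsub>N\<^esub> b" "c \<approx>\<^bsub>N\<^esub> d"
  shows "a * c \<approx>\<^bsub>N\<^esub> b * d"
proof -
  have "(a - b) * c + b * (c - d) \<in> rel_ideal N"
    using assms unfolding gl_cong_def
    by (intro rel_ideal.add rel_ideal_mult_left rel_ideal_mult_right)
  then show ?thesis by (simp add: gl_cong_def algebra_simps)
qed

lemma gl_cong_mult_left: "a \<approx>\<^bsub>N\<^esub> b \<Longrightarrow> c * a \<approx>\<^bsub>N\<^esub> c * b"
  and gl_cong_mult_right: "a \<approx>\<^bsub>N\<^esub> b \<Longrightarrow> a * c \<approx>\<^bsub>N\<^esub> b * c"
  by (simp_all add: gl_cong_mult)

lemma gl_cong_sum: "(\<And>x. x \<in> A \<Longrightarrow> f x \<approx>\<^bsub>N\<^esub> g x) \<Longrightarrow> sum f A \<approx>\<^bsub>N\<^esub> sum g A"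
  by (induction A rule: infinite_finite_induct) (auto intro: gl_cong_add)

lemma gl_cong_power: "a \<approx>\<^bsub>N\<^esub> b \<Longrightarrow> a ^ n \<approx>\<^bsub>N\<^esub> b ^ n"
  by (induction n) (auto intro: gl_cong_mult)

lemma EE_commutator:
  assumes "i < N" "j < N" "k < N" "l < N"
  shows "EE i j * EE k l - EE k l * EE i j
    \<approx>\<^bsub>N\<^esub> (if j = k then EE i l else 0) - (if l = i then EE k j else 0)"
  using rel_ideal.gen[OF assms, of 1 "[]" "[]"]
  by (simp add: gl_cong_def rel_elt_def word_Nil algebra_simps)

section \<open>Substitution homomorphisms\<close>

text \<open>Exponents outside the support are 0, so monomials with different supports can be
  compared over one index set.\<close>

lemma prod_keys_superset:
  fixes f :: "nat \<Rightarrow> 'a::comm_semiring_1"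
  assumes "finite A" "Poly_Mapping.keys mo \<subseteq> A"
  shows "(\<Prod>v\<in>Poly_Mapping.keys mo. f v ^ Poly_Mapping.lookup mo v) = (\<Prod>v\<in>A. f v ^ Poly_Mapping.lookup mo v)"
  using assms by (intro prod.mono_neutral_left) (auto simp: in_keys_iff)

lemma prod_keys_add:
  fixes f :: "nat \<Rightarrow> 'a::comm_semiring_1"
  shows "(\<Prod>v\<in>Poly_Mapping.keys (m1 + m2). f v ^ Poly_Mapping.lookup (m1 + m2) v) =
    (\<Prod>v\<in>Poly_Mapping.keys m1. f v ^ Poly_Mapping.lookup m1 v) *
    (\<Prod>v\<in>Poly_Mapping.keys m2. f v ^ Poly_Mapping.lookup m2 v)"
proof -
  let ?A = "Poly_Mapping.keys m1 \<union> Poly_Mapping.keys m2"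
  have "Poly_Mapping.keys (m1 + m2) \<subseteq> ?A" by (auto simp: in_keys_iff lookup_add)
  then show ?thesis
    by (subst (1 2 3) prod_keys_superset[of ?A]) (simp_all add: lookup_add power_add prod.distrib)
qed

lemma pconst_add: "pconst (a + b) = pconst a + pconst b"
  by (simp add: pconst_def single_add)

lemma pconst_mult: "pconst (a * b) = pconst a * pconst b"
  by (simp add: pconst_def mult_single)

lemma pconst_0 [simp]: "pconst 0 = 0" and pconst_1 [simp]: "pconst 1 = 1"
  by (simp_all add: pconst_def)

lemma psubst_add: "psubst f (p + q) = psubst f p + psubst f q"
  unfolding psubst_def
  by (rule setsum_keys_plus_distrib) (simp_all add: pconst_add distrib_right)

lemma psubst_single:
  "psubst f (Poly_Mapping.single mo c) = pconst c * (\<Prod>v\<in>Poly_Mapping.keys mo. f v ^ Poly_Mapping.lookup mo v)"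
  unfolding psubst_def by simp

lemma psubst_0 [simp]: "psubst f 0 = 0"
  by (simp add: psubst_def)

lemma psubst_mult: "psubst f (p * q) = psubst f p * psubst f q"
proof (induction p rule: poly_mapping_induct_single)
  case (single m1 c)
  show ?case
  proof (induction q rule: poly_mapping_induct_single)
    case (single m2 d)
    show ?case
      unfolding mult_single psubst_single prod_keys_add pconst_mult by (simp only: mult_ac)
  qed (simp_all add: psubst_add distrib_left)
qed (simp_all add: psubst_add distrib_right)

lemma psubst_pconst [simp]: "psubst f (pconst c) = pconst c"
  by (simp add: pconst_def psubst_single)

lemma psubst_1 [simp]: "psubst f 1 = 1"
  using psubst_pconst[of f 1] by simp

lemma psubst_pvar [simp]: "psubst f (pvar v) = f v"
  by (simp add: pvar_def psubst_single)

lemma psubst_uminus: "psubst f (- p) = - psubst f p"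
  using psubst_add[of f p "- p"] by (simp add: eq_neg_iff_add_eq_0 add.commute)

lemma psubst_diff: "psubst f (p - q) = psubst f p - psubst f q"
  using psubst_add[of f p "- q"] by (simp add: psubst_uminus)

lemma psubst_power: "psubst f (p ^ n) = psubst f p ^ n"
  by (induction n) (simp_all add: psubst_mult)

lemma psubst_sum: "psubst f (sum g A) = (\<Sum>x\<in>A. psubst f (g x))"
  by (induction A rule: infinite_finite_induct) (simp_all add: psubst_add)

lemma psubst_prod: "psubst f (prod g A) = (\<Prod>x\<in>A. psubst f (g x))"
  by (induction A rule: infinite_finite_induct) (simp_all add: psubst_mult)

lemma psubst_of_nat [simp]: "psubst f (of_nat n) = of_nat n"
  by (induction n) (simp_all add: psubst_add)

lemma psubst_psubst: "psubst f (psubst g p) = psubst (\<lambda>v. psubst f (g v)) p"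
  unfolding psubst_def[of g] psubst_def[of "\<lambda>v. psubst f (g v)"]
  by (simp add: psubst_sum psubst_mult psubst_prod psubst_power)


section \<open>Matrix powers and Casimir elements\<close>

fun mpow :: "nat \<Rightarrow> nat \<Rightarrow> nat \<Rightarrow> nat \<Rightarrow> nca" where
  "mpow N 0 i j = (if i = j then 1 else 0)"
| "mpow N (Suc p) i j = (\<Sum>k<N. EE i k * mpow N p k j)"

lemma if_mult_0: "(if P then a else 0) * b = (if P then a * b else 0)"
  "b * (if P then a else 0) = (if P then b * a else (0::'a::mult_zero))"
  by auto

lemma mpow_Suc_right:
  assumes "i < N" "j < N"
  shows "mpow N (Suc p) i j = (\<Sum>k<N. mpow N p i k * EE k j)"
  using assms
proof (induction p arbitrary: i)
  case 0
  then show ?case by (simp add: if_mult_0 sum.delta sum.delta')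
next
  case (Suc p)
  have "mpow N (Suc (Suc p)) i j = (\<Sum>l<N. EE i l * (\<Sum>k<N. mpow N p l k * EE k j))"
    using Suc by (subst mpow.simps(2)) (intro sum.cong, auto)
  also have "\<dots> = (\<Sum>k<N. \<Sum>l<N. EE i l * mpow N p l k * EE k j)"
    unfolding sum_distrib_left mult.assoc by (rule sum.swap)
  finally show ?case by (simp add: sum_distrib_right)
qed

text \<open>The entries of E^p transform under the adjoint action exactly as the entries of E do. In
  the induction the Leibniz rule yields the product E_kj (E^p)_il once with each sign; the two
  cancel between facts \<open>3\<close> and \<open>4\<close>.\<close>

lemma EE_mpow_commutator:
  assumes "i < N" "j < N" "k < N" "l < N"
  shows "EE i j * mpow N p k l - mpow N p k l * EE i j
    \<approx>\<^bsub>N\<^esub> (if j = k then mpow N p i l else 0) - (if l = i then mpow N p k j else 0)"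
  using assms
proof (induction p arbitrary: k)
  case 0
  then show ?case by auto
next
  case (Suc p)
  let ?X = "mpow N p"
  have 1: "EE i j * mpow N (Suc p) k l - mpow N (Suc p) k l * EE i j =
      (\<Sum>m<N. (EE i j * EE k m - EE k m * EE i j) * ?X m l + EE k m * (EE i j * ?X m l - ?X m l * EE i j))"
    by (simp add: sum_distrib_left sum_distrib_right sum_subtractf[symmetric] algebra_simps)
  have 2: "\<dots> \<approx>\<^bsub>N\<^esub> (\<Sum>m<N. ((if j = k then EE i m else 0) - (if m = i then EE k j else 0)) * ?X m l
       + EE k m * ((if j = m then ?X i l else 0) - (if l = i then ?X m j else 0)))"
    by (intro gl_cong_sum gl_cong_add gl_cong_mult gl_cong_refl EE_commutator Suc.IH)
       (simp_all add: Suc.prems)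
  have 3: "(\<Sum>m<N. ((if j = k then EE i m else 0) - (if m = i then EE k j else 0)) * ?X m l) =
       (if j = k then mpow N (Suc p) i l else 0) - EE k j * ?X i l"
    using \<open>i < N\<close> by (cases "j = k") (simp_all add: left_diff_distrib sum_subtractf sum_negf if_mult_0 sum.delta)
  have 4: "(\<Sum>m<N. EE k m * ((if j = m then ?X i l else 0) - (if l = i then ?X m j else 0))) =
       EE k j * ?X i l - (if l = i then mpow N (Suc p) k j else 0)"
    using \<open>j < N\<close> by (cases "l = i") (simp_all add: right_diff_distrib sum_subtractf sum_negf if_mult_0 sum.delta)
  have 5: "(\<Sum>m<N. ((if j = k then EE i m else 0) - (if m = i then EE k j else 0)) * ?X m l
       + EE k m * ((if j = m then ?X i l else 0) - (if l = i then ?X m j else 0))) =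
     (if j = k then mpow N (Suc p) i l else 0) - (if l = i then mpow N (Suc p) k j else 0)"
    unfolding sum.distrib 3 4 by simp
  show ?case using 2 unfolding 1 5 .
qed

section \<open>Casimir elements as traces of matrix powers\<close>

lemma sum_PiE_list:
  assumes "distinct cs"
  shows "(\<Sum>i\<in>set cs \<rightarrow>\<^sub>E S. g (map i cs)) = (\<Sum>xs | length xs = length cs \<and> set xs \<subseteq> S. g xs)"
proof (rule sum.reindex_bij_witness[where j = "\<lambda>i. map i cs"
      and i = "\<lambda>xs. restrict (\<lambda>x. the (map_of (zip cs xs) x)) (set cs)"])
  fix i assume i: "i \<in> set cs \<rightarrow>\<^sub>E S"
  show "restrict (\<lambda>x. the (map_of (zip cs (map i cs)) x)) (set cs) = i"
  proof
    fix x
    show "restrict (\<lambda>x. the (map_of (zip cs (map i cs)) x)) (set cs) x = i x"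
      using PiE_arb[OF i, of x] by (cases "x \<in> set cs") (simp_all add: map_of_zip_map)
  qed
  show "map i cs \<in> {xs. length xs = length cs \<and> set xs \<subseteq> S}"
    using PiE_mem[OF i] by auto
next
  fix xs assume xs: "xs \<in> {xs. length xs = length cs \<and> set xs \<subseteq> S}"
  have n: "map_of (zip cs xs) (cs ! k) = Some (xs ! k)" if "k < length cs" for k
    using xs assms that by (intro map_of_zip_nth) auto
  show "map (restrict (\<lambda>x. the (map_of (zip cs xs) x)) (set cs)) cs = xs"
    using xs n by (simp add: list_eq_iff_nth_eq)
  show "restrict (\<lambda>x. the (map_of (zip cs xs) x)) (set cs) \<in> set cs \<rightarrow>\<^sub>E S"
  proof (rule restrict_PiE_iff[THEN iffD2], rule ballI)
    fix x assume "x \<in> set cs"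
    then obtain k where k: "k < length cs" "x = cs ! k" by (auto simp: in_set_conv_nth)
    then have "xs ! k \<in> set xs" using xs by auto
    then show "the (map_of (zip cs xs) x) \<in> S" using xs k n by auto
  qed
qed simp

lemma sum_lists_Suc:
  "(\<Sum>xs | length xs = Suc k \<and> set xs \<subseteq> S. g xs) =
   (\<Sum>x\<in>S. \<Sum>xs | length xs = k \<and> set xs \<subseteq> S. g (x # xs))"
proof (cases "finite S")
  case True
  show ?thesis
    unfolding sum.cartesian_product
    by (rule sum.reindex_bij_witness[where i = "\<lambda>(x, xs). x # xs" and j = "\<lambda>xs. (hd xs, tl xs)"])
       (auto simp: length_Suc_conv)
next
  case False
  \<comment> \<open>For infinite S both sides are sums over infinite sets, hence 0; constant lists
    embed S.\<close>
  have "infinite {xs. length xs = Suc k \<and> set xs \<subseteq> S}"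
  proof
    assume "finite {xs. length xs = Suc k \<and> set xs \<subseteq> S}"
    moreover have "(\<lambda>x. replicate (Suc k) x) ` S \<subseteq> {xs. length xs = Suc k \<and> set xs \<subseteq> S}"
      by auto
    ultimately have "finite ((\<lambda>x. replicate (Suc k) x) ` S)" by (rule finite_subset[rotated])
    with False show False by (auto dest!: finite_imageD simp: inj_on_def)
  qed
  with False show ?thesis by simp
qed

text \<open>The list xs holds the inner vertices of a walk from a to b with k + 1 steps.\<close>

lemma mpow_eq_sum_paths:
  assumes "b < N"
  shows "mpow N (Suc k) a b = (\<Sum>xs | length xs = k \<and> set xs \<subseteq> {0..<N}. word (zip (a # xs) (xs @ [b])))"
proof (induction k arbitrary: a)
  case 0
  have "{xs. xs = [] \<and> set xs \<subseteq> {0..<N}} = {[]}" by auto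
  then show ?case using assms by (simp add: if_mult_0 sum.delta)
next
  case (Suc k)
  have "word (zip (a # x # xs) ((x # xs) @ [b])) = EE a x * word (zip (x # xs) (xs @ [b]))" for x xs
    using word_Cons[of a x "zip (x # xs) (xs @ [b])"] by simp
  then show ?case
    unfolding sum_lists_Suc mpow.simps(2)[of N "Suc k"] Suc
    by (simp only: sum_distrib_left lessThan_atLeast0)
qed

definition casim :: "nat \<Rightarrow> nat \<Rightarrow> nca" where
  "casim N k = (\<Sum>i\<in>{0..<k} \<rightarrow>\<^sub>E {0..<N}. word (map (\<lambda>s. (i s, i (long_cycle k s))) [0..<k]))"

lemma lookup_casim: "Poly_Mapping.lookup (casim N k) = Casimir N k"
  by (simp add: casim_def Casimir_def w_glN_def lookup_nca_sum lookup_word)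

lemma cycle_word: 
  "map (\<lambda>s. (i s, i (long_cycle k s))) [0..<k] = zip (map i [0..<k]) (rotate1 (map i [0..<k]))"
  by (rule nth_equalityI) (auto simp: long_cycle_def nth_rotate1)

text \<open>The case k = 0 differs: the index set then has one element and \<open>casim N 0\<close>
  is 1, whereas the trace of the identity matrix is N.\<close>

lemma casim_eq_trace:
  assumes "k \<ge> 1"
  shows "casim N k = (\<Sum>i<N. mpow N k i i)"
proof -
  obtain m where k: "k = Suc m" using assms by (cases k) auto
  have "casim N k = (\<Sum>xs | length xs = k \<and> set xs \<subseteq> {0..<N}. word (zip xs (rotate1 xs)))"
    unfolding casim_def cycle_word
    using sum_PiE_list[of "[0..<k]" "\<lambda>xs. word (zip xs (rotate1 xs))" "{0..<N}"] by simp
  also have "\<dots> = (\<Sum>i<N. mpow N k i i)"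
    unfolding k sum_lists_Suc lessThan_atLeast0
    by (intro sum.cong refl, subst mpow_eq_sum_paths) simp_all
  finally show ?thesis .
qed

text \<open>In the trace of the commutation rule the two Kronecker deltas select the same entry
  (E^k)_ij with opposite signs.\<close>

lemma casim_central:
  assumes "k \<ge> 1" "i < N" "j < N"
  shows "EE i j * casim N k \<approx>\<^bsub>N\<^esub> casim N k * EE i j"
proof -
  have "EE i j * casim N k - casim N k * EE i j = (\<Sum>l<N. EE i j * mpow N k l l - mpow N k l l * EE i j)"
    using assms by (simp add: casim_eq_trace sum_distrib_left sum_distrib_right sum_subtractf)
  also have "\<dots> \<approx>\<^bsub>N\<^esub> (\<Sum>l<N. (if j = l then mpow N k i l else 0) - (if l = i then mpow N k l j else 0))"
    using assms by (intro gl_cong_sum EE_mpow_commutator) auto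
  also have "\<dots> = 0"
    using assms by (simp add: sum_subtractf)
  finally show ?thesis by (simp add: gl_cong_def)
qed

lemma casim_central_word:
  assumes "k \<ge> 1" "set w \<subseteq> {0..<N} \<times> {0..<N}"
  shows "word w * casim N k \<approx>\<^bsub>N\<^esub> casim N k * word w"
  using assms(2)
proof (induction w)
  case Nil
  show ?case by (simp add: word_Nil)
next
  case (Cons x w)
  obtain i j where x: "x = (i, j)" by (cases x)
  have "word (x # w) * casim N k = EE i j * (word w * casim N k)"
    by (simp add: x word_Cons[of i j w] mult.assoc)
  also have "\<dots> \<approx>\<^bsub>N\<^esub> EE i j * (casim N k * word w)"
    using Cons by (intro gl_cong_mult_left) auto
  also have "\<dots> = (EE i j * casim N k) * word w" by (simp add: mult.assoc)
  also have "\<dots> \<approx>\<^bsub>N\<^esub> (casim N k * EE i j) * word w"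
    using Cons.prems assms(1) x by (intro gl_cong_mult_right casim_central) auto
  also have "\<dots> = casim N k * word (x # w)" by (simp add: x word_Cons[of i j w] mult.assoc)
  finally show ?case .
qed

lemma casim_commute:
  assumes "k \<ge> 1"
  shows "casim N l * casim N k \<approx>\<^bsub>N\<^esub> casim N k * casim N l"
proof -
  have "set (map (\<lambda>s. (i s, i (long_cycle l s))) [0..<l]) \<subseteq> {0..<N} \<times> {0..<N}"
    if "i \<in> {0..<l} \<rightarrow>\<^sub>E {0..<N}" for i
    using that by (auto simp: long_cycle_def PiE_def Pi_def)
  then show ?thesis
    unfolding casim_def[of N l] sum_distrib_left sum_distrib_right
    by (intro gl_cong_sum casim_central_word assms)
qed


section \<open>Specialisation is a homomorphism modulo the relations\<close>

lemma gl_commute_mult: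
  assumes "a * c \<approx>\<^bsub>N\<^esub> c * a" "b * c \<approx>\<^bsub>N\<^esub> c * b"
  shows "a * b * c \<approx>\<^bsub>N\<^esub> c * (a * b)"
proof -
  have "a * b * c = a * (b * c)" by (simp add: mult.assoc)
  also have "\<dots> \<approx>\<^bsub>N\<^esub> a * (c * b)" using assms by (intro gl_cong_mult_left)
  also have "\<dots> = a * c * b" by (simp add: mult.assoc)
  also have "\<dots> \<approx>\<^bsub>N\<^esub> c * a * b" using assms by (intro gl_cong_mult_right)
  finally show ?thesis by (simp add: mult.assoc)
qed

lemma gl_commute_power: "a * c \<approx>\<^bsub>N\<^esub> c * a \<Longrightarrow> a ^ n * c \<approx>\<^bsub>N\<^esub> c * a ^ n"
  by (induction n) (auto intro: gl_commute_mult)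

text \<open>The list fixes the order of the factors, in the shape of the fold in
  \<open>specialize\<close>; reordering is only a congruence.\<close>

definition cmon :: "nat \<Rightarrow> (nat \<Rightarrow> nat) \<Rightarrow> nat list \<Rightarrow> nca" where
  "cmon N e ks = foldr (\<lambda>k acc. casim N k ^ e k * acc) ks 1"

lemma cmon_simps [simp]:
  "cmon N e [] = 1" "cmon N e (k # ks) = casim N k ^ e k * cmon N e ks"
  by (simp_all add: cmon_def)

lemma cmon_commute:
  assumes "k \<ge> 1"
  shows "cmon N e ks * casim N k ^ n \<approx>\<^bsub>N\<^esub> casim N k ^ n * cmon N e ks"
proof (induction ks)
  case (Cons l ks)
  have "casim N l * casim N k ^ n \<approx>\<^bsub>N\<^esub> casim N k ^ n * casim N l"
    by (rule gl_cong_sym, rule gl_commute_power, rule gl_cong_sym, rule casim_commute[OF assms])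
  then show ?case using Cons by (auto intro: gl_commute_mult gl_commute_power)
qed simp

lemma cmon_add:
  assumes "0 \<notin> set ks"
  shows "cmon N (\<lambda>k. d k + e k) ks \<approx>\<^bsub>N\<^esub> cmon N d ks * cmon N e ks"
  using assms
proof (induction ks)
  case (Cons k ks)
  let ?c = "casim N k"
  have "cmon N (\<lambda>k. d k + e k) (k # ks) \<approx>\<^bsub>N\<^esub> ?c ^ (d k + e k) * (cmon N d ks * cmon N e ks)"
    using Cons by (auto intro: gl_cong_mult_left)
  also have "\<dots> = ?c ^ d k * (?c ^ e k * cmon N d ks) * cmon N e ks"
    by (simp add: power_add mult.assoc)
  also have "\<dots> \<approx>\<^bsub>N\<^esub> ?c ^ d k * (cmon N d ks * ?c ^ e k) * cmon N e ks"
    using Cons.prems by (intro gl_cong_mult_right gl_cong_mult_left gl_cong_sym[OF cmon_commute]) auto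
  finally show ?case by (simp add: mult.assoc)
qed simp

lemma cmon_filter:
  assumes "\<And>k. k \<in> set ks \<Longrightarrow> \<not> P k \<Longrightarrow> e k = 0"
  shows "cmon N e (filter P ks) = cmon N e ks"
  using assms by (induction ks) auto

text \<open>Replaces the support of a monomial by a common interval, so that two monomials multiply
  factor by factor. The interval starts at 1 because variable 0 is N.\<close>

lemma cmon_keys:
  assumes "Poly_Mapping.keys mo \<subseteq> {..<B}"
  shows "cmon N (Poly_Mapping.lookup mo) (sorted_list_of_set (Poly_Mapping.keys mo - {0})) =
         cmon N (Poly_Mapping.lookup mo) [1..<B]"
proof -
  let ?A = "Poly_Mapping.keys mo - {0}"
  have "sorted_list_of_set ?A = filter (\<lambda>k. k \<in> ?A) [1..<B]"
    using assms by (intro sorted_distinct_set_unique) (auto simp: sorted_wrt_filter)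
  then show ?thesis
    by (auto simp: in_keys_iff intro!: cmon_filter)
qed

definition spec :: "nat \<Rightarrow> mpoly \<Rightarrow> nca" where
  "spec N p = (\<Sum>mo\<in>Poly_Mapping.keys p.
     scal (Poly_Mapping.lookup p mo * of_nat N ^ Poly_Mapping.lookup mo 0) *
     cmon N (Poly_Mapping.lookup mo) (sorted_list_of_set (Poly_Mapping.keys mo - {0})))"

lemma lookup_cmon:
  "Poly_Mapping.lookup (cmon N e ks) = foldr (\<lambda>k acc. fmul (fpow (Casimir N k) (e k)) acc) ks (fmono [])"
  by (induction ks) (simp_all add: lookup_nca_mult lookup_nca_one lookup_nca_power lookup_casim)

lemma lookup_spec: "Poly_Mapping.lookup (spec N p) = specialize N p"
  unfolding spec_def specialize_def lookup_nca_sum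
  by (simp only: lookup_nca_scal lookup_cmon)

lemma spec_add: "spec N (p + q) = spec N p + spec N q"
  unfolding spec_def
  by (rule setsum_keys_plus_distrib) (simp_all add: single_add distrib_right)

lemma spec_single:
  "spec N (Poly_Mapping.single mo c) = scal (c * of_nat N ^ Poly_Mapping.lookup mo 0) *
     cmon N (Poly_Mapping.lookup mo) (sorted_list_of_set (Poly_Mapping.keys mo - {0}))"
  unfolding spec_def by simp

lemma spec_0 [simp]: "spec N 0 = 0"
  by (simp add: spec_def)

lemma spec_uminus: "spec N (- p) = - spec N p"
  using spec_add[of N p "- p"] by (simp add: eq_neg_iff_add_eq_0 add.commute)

lemma spec_diff: "spec N (p - q) = spec N p - spec N q"
  using spec_add[of N p "- q"] by (simp add: spec_uminus)

lemma spec_sum: "spec N (sum f A) = (\<Sum>x\<in>A. spec N (f x))"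
  by (induction A rule: infinite_finite_induct) (simp_all add: spec_add)

lemma spec_pconst: "spec N (pconst c) = scal c"
  by (simp add: pconst_def spec_single)

lemma spec_1 [simp]: "spec N 1 = 1"
  using spec_pconst[of N 1] by simp

lemma spec_pN: "spec N pN = scal (of_nat N)"
  by (simp add: pvar_def spec_single)

lemma spec_pvar: "k \<ge> 1 \<Longrightarrow> spec N (pvar k) = casim N k"
  by (simp add: pvar_def spec_single lookup_single)

text \<open>Only a congruence, since collecting the powers of one Casimir element moves factors past
  each other.\<close>

lemma spec_mult: "spec N (p * q) \<approx>\<^bsub>N\<^esub> spec N p * spec N q"
proof (induction p rule: poly_mapping_induct_single)
  case (single m1 c)
  show ?case
  proof (induction q rule: poly_mapping_induct_single)
    case (single m2 d)
    obtain B where B: "Poly_Mapping.keys m1 \<union> Poly_Mapping.keys m2 \<subseteq> {..<B}"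
      using finite_nat_set_iff_bounded[of "Poly_Mapping.keys m1 \<union> Poly_Mapping.keys m2"]
      by (auto simp: subset_iff)
    then have B': "Poly_Mapping.keys (m1 + m2) \<subseteq> {..<B}" 
      using keys_add[of m1 m2] by blast
    let ?n = "of_nat N :: complex"
    let ?k1 = "c * ?n ^ Poly_Mapping.lookup m1 0" and ?k2 = "d * ?n ^ Poly_Mapping.lookup m2 0"
    let ?M1 = "cmon N (Poly_Mapping.lookup m1) [1..<B]" and ?M2 = "cmon N (Poly_Mapping.lookup m2) [1..<B]"
    have l: "Poly_Mapping.lookup (m1 + m2) = (\<lambda>k. Poly_Mapping.lookup m1 k + Poly_Mapping.lookup m2 k)"
      by (simp add: fun_eq_iff lookup_add)
    have "spec N (Poly_Mapping.single m1 c * Poly_Mapping.single m2 d) =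
       scal (?k1 * ?k2) * cmon N (\<lambda>k. Poly_Mapping.lookup m1 k + Poly_Mapping.lookup m2 k) [1..<B]"
      unfolding mult_single[of m1 c] spec_single cmon_keys[OF B'] unfolding l
      by (simp add: power_add mult_ac)
    also have "\<dots> \<approx>\<^bsub>N\<^esub> scal (?k1 * ?k2) * (?M1 * ?M2)"
      by (intro gl_cong_mult_left cmon_add) auto
    also have "\<dots> = scal ?k1 * (scal ?k2 * ?M1) * ?M2" by (simp only: scal_mult mult.assoc)
    also have "\<dots> = spec N (Poly_Mapping.single m1 c) * spec N (Poly_Mapping.single m2 d)"
    proof -
      have "Poly_Mapping.keys m1 \<subseteq> {..<B}" "Poly_Mapping.keys m2 \<subseteq> {..<B}" using B by auto
      then show ?thesis
        unfolding spec_single by (simp only: cmon_keys scal_commute[of ?k2 ?M1] mult.assoc)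
    qed
    finally show ?case .
  qed (auto simp: spec_add distrib_left intro: gl_cong_add)
qed (auto simp: spec_add distrib_right intro: gl_cong_add)

lemma spec_power: "spec N (p ^ n) \<approx>\<^bsub>N\<^esub> spec N p ^ n"
proof (induction n)
  case (Suc n)
  have "spec N (p ^ Suc n) \<approx>\<^bsub>N\<^esub> spec N p * spec N (p ^ n)" using spec_mult by simp
  also have "\<dots> \<approx>\<^bsub>N\<^esub> spec N p * spec N p ^ n" using Suc by (intro gl_cong_mult_left)
  finally show ?case by simp
qed simp

section \<open>The Schur substitution and the sign flip\<close>

unbundle fps_syntax

definition fps_psubst :: "(nat \<Rightarrow> mpoly) \<Rightarrow> mpoly fps \<Rightarrow> mpoly fps" where
  "fps_psubst f F = Abs_fps (\<lambda>n. psubst f (F $ n))"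

lemma fps_psubst_nth [simp]: "fps_psubst f F $ n = psubst f (F $ n)"
  by (simp add: fps_psubst_def)

lemma fps_psubst_mult: "fps_psubst f (F * G) = fps_psubst f F * fps_psubst f G"
  by (simp add: fps_eq_iff fps_mult_nth psubst_sum psubst_mult)

lemma fps_psubst_1 [simp]: "fps_psubst f 1 = 1"
  by (simp add: fps_eq_iff)

lemma fps_psubst_uminus: "fps_psubst f (- F) = - fps_psubst f F"
  by (simp add: fps_eq_iff psubst_uminus)

lemma fps_psubst_power: "fps_psubst f (F ^ n) = fps_psubst f F ^ n"
  by (induction n) (simp_all add: fps_psubst_mult)

lemma fps_psubst_compose: "fps_psubst f (F oo G) = fps_psubst f F oo fps_psubst f G"
  by (simp add: fps_eq_iff fps_compose_nth psubst_sum psubst_mult fps_psubst_power[symmetric])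

definition schur_S :: "mpoly fps" where
  "schur_S = Abs_fps (\<lambda>i. if i = 0 then 1 else pvar i)"

definition binser :: "mpoly fps" where
  "binser = Abs_fps binomN"

text \<open>Written as a composition, the series lets a substitution for u or for the variables S_i
  act on each ingredient separately.\<close>

lemma schur_D_eq: "w $ 0 = 0 \<Longrightarrow> schur_D w = schur_S oo w"
  by (auto simp: fps_eq_iff schur_D_def schur_S_def fps_compose_nth sum.atLeast_Suc_atMost
      intro!: sum.cong)

lemma schur_R_eq: "schur_R = binser oo (- schur_y)"
  by (simp add: fps_eq_iff schur_R_def binser_def fps_compose_nth atLeast0AtMost)

section \<open>The fractional linear series y and z, and the substitution that exchanges
  them\<close>

abbreviation pP :: mpoly where "pP \<equiv> (pN + 1) * pconst (1/2)"
abbreviation pM :: mpoly where "pM \<equiv> (pN - 1) * pconst (1/2)"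

lemma pconst_half: "pconst (1/2) + pconst (1/2) = 1"
  by (simp flip: pconst_add)

text \<open>The constants (N+1)/2 and (N-1)/2 enter through two relations: their difference 1 gives
  (1 - y)(1 + z) = 1, and their sum N makes \<open>schur_s\<close> exchange y and z up to
  sign.\<close>

lemma pP_minus_pM: "pP - pM = 1"
  using pconst_half by (simp add: algebra_simps)

lemma pP_plus_pM: "pP + pM = pN"
proof -
  have "pP + pM = pN * (pconst (1/2) + pconst (1/2))" by (simp add: algebra_simps)
  then show ?thesis by (simp add: pconst_half)
qed

text \<open>The series u / (1 - a u), characterised by \<open>mobius_eq\<close>.\<close>

definition mobius :: "mpoly \<Rightarrow> mpoly fps" where
  "mobius a = Abs_fps (\<lambda>k. if k = 0 then 0 else a ^ (k - 1))"

lemma mobius_nth_0 [simp]: "mobius a $ 0 = 0"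
  by (simp add: mobius_def)

lemma mobius_eq: "mobius a * (1 - fps_const a * fps_X) = fps_X"
proof (rule fps_ext)
  fix n
  show "(mobius a * (1 - fps_const a * fps_X)) $ n = fps_X $ n"
  proof (cases n)
    case 0
    then show ?thesis by simp
  next
    case (Suc m)
    have "(mobius a * (1 - fps_const a * fps_X)) $ Suc m = mobius a $ Suc m - mobius a $ m * a"
      by (simp add: right_diff_distrib mult.assoc[symmetric])
    then show ?thesis by (cases m) (simp_all add: Suc mobius_def)
  qed
qed

lemma schur_y_eq: "schur_y = mobius pM" and schur_z_eq: "schur_z = mobius pP"
  by (simp_all add: schur_y_def schur_z_def mobius_def)

lemma one_minus_const_X_nonzero: "1 - fps_const (a::mpoly) * fps_X \<noteq> 0"
proof
  assume "1 - fps_const a * fps_X = 0"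
  then have "(1 - fps_const a * fps_X) $ 0 = 0" by simp
  then show False by simp
qed

lemma mobius_unique:
  assumes "w * (1 - fps_const a * fps_X) = fps_X"
  shows "w = mobius a"
proof -
  have "w * (1 - fps_const a * fps_X) = mobius a * (1 - fps_const a * fps_X)"
    by (simp add: mobius_eq assms)
  then show ?thesis using one_minus_const_X_nonzero[of a] by simp
qed

definition schur_s :: "mpoly fps" where "schur_s = - mobius pN"

lemma schur_s_0 [simp]: "schur_s $ 0 = 0"
  by (simp add: schur_s_def)

text \<open>With s = - u / (1 - N u) one gets s / (1 - a s) = - u / (1 - (N - a) u).\<close>

lemma mobius_compose_schur_s:
  assumes "a + b = pN"
  shows "mobius a oo schur_s = - mobius b"
proof -
  let ?d = "1 - fps_const pN * fps_X"
  let ?m = "mobius a oo schur_s"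
  have s: "schur_s * ?d = - fps_X"
    using mobius_eq[of pN] by (simp add: schur_s_def)
  have "(mobius a * (1 - fps_const a * fps_X)) oo schur_s = fps_X oo schur_s"
    by (simp add: mobius_eq)
  then have "?m * (1 - fps_const a * schur_s) = schur_s"
    by (simp add: fps_compose_mult_distrib fps_compose_sub_distrib)
  then have "?m * (1 - fps_const a * schur_s) * ?d = schur_s * ?d" by simp
  moreover have "(1 - fps_const a * schur_s) * ?d = 1 - fps_const b * fps_X"
  proof -
    have *: "1 - (A + B) * X - A * (- X) = 1 - B * X" for A B X :: "mpoly fps"
      by (simp add: algebra_simps)
    have c: "fps_const pN = fps_const a + fps_const b" by (simp flip: assms)
    have "(1 - fps_const a * schur_s) * ?d = ?d - fps_const a * (schur_s * ?d)"
      by (simp only: left_diff_distrib mult_1 mult.assoc)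
    also have "\<dots> = 1 - fps_const b * fps_X"
      unfolding s unfolding c by (rule *)
    finally show ?thesis .
  qed
  ultimately have "?m * (1 - fps_const b * fps_X) = - fps_X" by (simp add: s mult.assoc)
  then have "- ?m * (1 - fps_const b * fps_X) = fps_X" by simp
  then have "- ?m = mobius b" by (rule mobius_unique)
  then show ?thesis by (metis minus_minus)
qed

lemma schur_y_compose: "schur_y oo schur_s = - schur_z"
  and schur_z_compose: "schur_z oo schur_s = - schur_y"
  using mobius_compose_schur_s[of pM pP] mobius_compose_schur_s[of pP pM] pP_plus_pM
  by (simp_all add: schur_y_eq schur_z_eq add.commute)

text \<open>1 - y is the fraction (1 - (N+1)u/2) / (1 - (N-1)u/2) and 1 + z is its inverse; the
  proof clears the denominators.\<close>

lemma schur_y_z: "(1 - schur_y) * (1 + schur_z) = 1"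
proof -
  let ?p = "1 - fps_const pP * fps_X" and ?m = "1 - fps_const pM * fps_X"
  have pm: "?m - ?p = fps_X"
  proof -
    have *: "(1 - B * X) - (1 - A * X) = (A - B) * X" for A B X :: "mpoly fps"
      by (simp add: algebra_simps)
    have "?m - ?p = fps_const (pP - pM) * fps_X"
      unfolding fps_const_sub[symmetric] by (rule *)
    then show ?thesis by (simp only: pP_minus_pM) simp
  qed
  have y: "schur_y * ?m = fps_X" and z: "schur_z * ?p = fps_X"
    by (simp_all only: schur_y_eq schur_z_eq mobius_eq)
  have 1: "(1 - schur_y) * ?m = ?p" using y pm by (simp only: left_diff_distrib) (simp add: algebra_simps)
  have 2: "(1 + schur_z) * ?p = ?m" using z pm by (simp only: distrib_right) (simp add: algebra_simps)
  have "((1 - schur_y) * (1 + schur_z)) * (?m * ?p) = ((1 - schur_y) * ?m) * ((1 + schur_z) * ?p)"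
    by (simp only: mult_ac)
  also have "\<dots> = 1 * (?m * ?p)" unfolding 1 2 by (simp only: mult_ac mult_1)
  finally have "((1 - schur_y) * (1 + schur_z)) * (?m * ?p) = 1 * (?m * ?p)" .
  moreover have "?m * ?p \<noteq> 0" using one_minus_const_X_nonzero by simp
  ultimately show ?thesis by (simp only: mult_cancel_right) simp
qed

section \<open>The binomial series with indeterminate exponent\<close>

lemma binomN_Suc: "of_nat (Suc n) * binomN (Suc n) = (pN - of_nat n) * binomN n"
proof -
  have "of_nat (Suc n) = pconst (of_nat (Suc n))"
    by (simp only: pconst_def single_of_nat)
  then have "of_nat (Suc n) * pconst (1 / fact (Suc n)) = pconst (of_nat (Suc n) * (1 / fact (Suc n)))"
    by (simp only: pconst_mult)
  also have "of_nat (Suc n) * (1 / fact (Suc n)) = (1 / fact n :: complex)"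
    by (simp add: field_simps del: of_nat_Suc)
  finally have *: "of_nat (Suc n) * pconst (1 / fact (Suc n)) = pconst (1 / fact n)" .
  have "of_nat (Suc n) * binomN (Suc n) =
      (of_nat (Suc n) * pconst (1 / fact (Suc n))) * (\<Prod>j<Suc n. pN - of_nat j)"
    by (simp only: binomN_def mult.assoc)
  then show ?thesis unfolding * by (simp add: binomN_def mult_ac)
qed

text \<open>With N an indeterminate, (1 + X)^N is given only by its coefficients; this differential
  equation takes the place of the laws of powers.\<close>

lemma binser_ode: "fps_deriv binser * (1 + fps_X) = fps_const pN * binser"
proof (rule fps_ext)
  fix n
  show "(fps_deriv binser * (1 + fps_X)) $ n = (fps_const pN * binser) $ n"
  proof (cases n)
    case 0
    then show ?thesis using binomN_Suc[of 0] by (simp add: distrib_left binser_def)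
  next
    case (Suc m)
    have "(fps_deriv binser * (1 + fps_X)) $ Suc m =
        of_nat (Suc (Suc m)) * binomN (Suc (Suc m)) + of_nat (Suc m) * binomN (Suc m)"
      by (simp add: distrib_left binser_def)
    also have "\<dots> = pN * binomN (Suc m)"
      unfolding binomN_Suc[of "Suc m"] by (simp add: algebra_simps)
    finally show ?thesis by (simp add: Suc binser_def)
  qed
qed

text \<open>Logarithmic derivatives turn the product into a constant.\<close>
lemma binser_mult_inverse:
  assumes "w $ 0 = 0" "v $ 0 = 0" "(1 + w) * (1 + v) = 1"
  shows "(binser oo w) * (binser oo v) = 1"
proof -
  let ?P = "binser oo w" and ?Q = "binser oo v"
  have ode: "fps_deriv (binser oo x) * (1 + x) = fps_const pN * (binser oo x) * fps_deriv x"
    if "x $ 0 = 0" for x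
  proof -
    have "(fps_deriv binser * (1 + fps_X)) oo x = (fps_const pN * binser) oo x"
      by (simp add: binser_ode)
    then have *: "(fps_deriv binser oo x) * (1 + x) = fps_const pN * (binser oo x)"
      using that by (simp add: fps_compose_mult_distrib fps_compose_add_distrib)
    show ?thesis unfolding *[symmetric]
      unfolding fps_compose_deriv[OF that] by (simp only: mult_ac)
  qed
  have "fps_deriv ((1 + w) * (1 + v)) = 0" using assms(3) by simp
  then have d: "fps_deriv w * (1 + v) + (1 + w) * fps_deriv v = 0"
    by (simp add: algebra_simps)
  have "fps_deriv (?P * ?Q) * ((1 + w) * (1 + v)) =
      (fps_deriv ?P * (1 + w)) * (1 + v) * ?Q + (fps_deriv ?Q * (1 + v)) * (1 + w) * ?P"
    by (simp add: algebra_simps)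
  also have "\<dots> = fps_const pN * ?P * ?Q * (fps_deriv w * (1 + v) + (1 + w) * fps_deriv v)"
    unfolding ode[OF assms(1)] ode[OF assms(2)] by (simp add: algebra_simps)
  also have "\<dots> = 0" unfolding d by simp
  finally have "fps_deriv (?P * ?Q) = 0" using assms(3) by simp
  then have "?P * ?Q = fps_const ((?P * ?Q) $ 0)" by (simp only: fps_deriv_eq_0_iff)
  also have "(?P * ?Q) $ 0 = 1" by (simp add: binser_def binomN_def)
  finally show ?thesis by simp
qed

text \<open>The image of A(u) under the Schur substitution.\<close>

definition schur_F :: "mpoly fps" where
  "schur_F = Abs_fps (\<lambda>n. if n = 0 then 1 else if n = 1 then - pN else - schur_C (n - 1))"

text \<open>D(z) has constant term 1 and can be inverted, so the quotient G = R D(y) / D(z) is the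
  only candidate. It has the prescribed shape because its first two coefficients come out as 1 and
  -N.\<close>

lemma schur_C_ex1:
  "\<exists>!c. c 0 = 0 \<and> Abs_fps (\<lambda>n. if n = 0 then 1 else if n = 1 then - pN else - c (n - 1))
        * schur_D schur_z = schur_R * schur_D schur_y"
proof -
  let ?A = "\<lambda>c. Abs_fps (\<lambda>n. if n = 0 then 1 else if n = 1 then - pN else - c (n - 1))"
  let ?Dz = "schur_D schur_z"
  define I where "I = fps_right_inverse ?Dz 1"
  have Dz0: "?Dz $ 0 = 1" by (simp add: schur_D_def)
  then have I: "?Dz * I = 1" unfolding I_def by (intro fps_right_inverse) simp
  define G where "G = schur_R * schur_D schur_y * I"
  have G: "G * ?Dz = schur_R * schur_D schur_y"
    using I by (simp add: G_def mult.assoc mult.commute[of I])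
  have G0: "G $ 0 = 1"
  proof -
    have "(G * ?Dz) $ 0 = (schur_R * schur_D schur_y) $ 0" by (simp add: G)
    then show ?thesis by (simp add: Dz0 schur_R_def binomN_def) (simp add: schur_D_def)
  qed
  have G1: "G $ 1 = - pN"
  proof -
    have "(G * ?Dz) $ 1 = (schur_R * schur_D schur_y) $ 1" by (simp add: G)
    then have "G $ 0 * pvar 1 + G $ 1 = pvar 1 - pN"
      by (simp add: fps_mult_nth schur_R_def binomN_def schur_D_def schur_y_def schur_z_def)
    then have "G $ 1 + pN = 0" using G0 by (simp add: algebra_simps)
    then show ?thesis by (simp only: eq_neg_iff_add_eq_0)
  qed
  \<comment> \<open>C_n sits at u^(n+1). The value at 0 is fixed separately because the series does
    not see it.\<close>
  define c where "c n = (if n = 0 then 0 else - G $ Suc n)" for n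
  have "?A c = G"
  proof (rule fps_ext)
    fix n
    show "?A c $ n = G $ n"
      using G0 G1 by (cases n; cases "n - 1") (auto simp: c_def)
  qed
  then have ex: "c 0 = 0 \<and> ?A c * ?Dz = schur_R * schur_D schur_y"
    using G by (simp add: c_def)
  show ?thesis
  proof (rule ex1I[of _ c])
    fix d assume d: "d 0 = 0 \<and> ?A d * ?Dz = schur_R * schur_D schur_y"
    have "?A d * (?Dz * I) = ?A c * (?Dz * I)" using d ex by (simp only: mult.assoc[symmetric])
    then have *: "?A d = ?A c" using I by simp
    show "d = c"
    proof
      fix n
      show "d n = c n"
        using arg_cong[OF *, of "\<lambda>F. F $ Suc n"] d ex by (cases n) auto
    qed
  qed (fact ex)
qed

lemma schur_F_eq: "schur_F * schur_D schur_z = schur_R * schur_D schur_y"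
  using theI'[OF schur_C_ex1] unfolding schur_C_def[symmetric] schur_F_def by simp

abbreviation flip_img :: "nat \<Rightarrow> mpoly" where
  "flip_img \<equiv> (\<lambda>v. if v = 0 then pN else (-1) ^ v * pvar v)"

lemma fps_psubst_flip_mobius:
  assumes "psubst flip_img a = a"
  shows "fps_psubst flip_img (mobius a) = mobius a"
  by (simp add: fps_eq_iff mobius_def psubst_power assms)

text \<open>S_i stands at X^i, so flipping the signs amounts to replacing X by -X.\<close>

lemma fps_psubst_flip_S: "fps_psubst flip_img schur_S = schur_S oo (- fps_X)"
  by (simp add: fps_eq_iff schur_S_def fps_compose_uminus')

text \<open>Write A, S, s for \<open>schur_F\<close>, \<open>schur_S\<close>, \<open>schur_s\<close>
  and B for (1 + X)^N. From A S(z) = B(-y) S(y), flipping signs gives B(-y) S(-y) / S(-z) for the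
  flipped A, and composing with s gives B(z) S(-z) / S(-y) for A o s. In the product the S-factors
  cancel and B(-y) B(z) = 1 remains.\<close>

lemma schur_flip: "(schur_F oo schur_s) * fps_psubst flip_img schur_F = 1"
proof -
  let ?f = "fps_psubst flip_img"
  have fy: "?f schur_y = schur_y" and fz: "?f schur_z = schur_z"
    unfolding schur_y_eq schur_z_eq
    by (simp_all add: fps_psubst_flip_mobius psubst_mult psubst_add psubst_diff)
  have y0: "schur_y $ 0 = 0" and z0: "schur_z $ 0 = 0" by (simp_all add: schur_y_eq schur_z_eq)
  have fb: "?f binser = binser"
    by (simp add: fps_eq_iff binser_def binomN_def psubst_mult psubst_prod psubst_diff)
  have fS: "?f (schur_S oo w) = schur_S oo (- w)" if "?f w = w" "w $ 0 = 0" for w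
    using that by (simp add: fps_psubst_compose fps_psubst_flip_S fps_compose_assoc[symmetric] fps_compose_uminus)
  have eq: "schur_F * (schur_S oo schur_z) = (binser oo (- schur_y)) * (schur_S oo schur_y)"
    using schur_F_eq by (simp add: schur_D_eq y0 z0 schur_R_eq)
  from arg_cong[OF this, of ?f]
  have 1: "?f schur_F * (schur_S oo (- schur_z)) = (binser oo (- schur_y)) * (schur_S oo (- schur_y))"
    by (simp add: fps_psubst_mult fS fy fz y0 z0) (simp add: fps_psubst_compose fb fy fps_psubst_uminus)
  from arg_cong[OF eq, of "\<lambda>F. F oo schur_s"]
  have 2: "(schur_F oo schur_s) * (schur_S oo (- schur_y)) = (binser oo schur_z) * (schur_S oo (- schur_z))"
    by (simp add: fps_compose_mult_distrib fps_compose_assoc[symmetric] schur_y_compose schur_z_compose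
        y0 z0 fps_compose_uminus)
  have 3: "(binser oo (- schur_y)) * (binser oo schur_z) = 1"
    using schur_y_z by (intro binser_mult_inverse) (simp_all add: y0 z0)
  let ?Y = "schur_S oo (- schur_y)" and ?Z = "schur_S oo (- schur_z)"
  have "((schur_F oo schur_s) * ?f schur_F) * (?Y * ?Z) =
     ((schur_F oo schur_s) * ?Y) * (?f schur_F * ?Z)" by (simp only: mult_ac)
  also have "\<dots> = ((binser oo (- schur_y)) * (binser oo schur_z)) * (?Y * ?Z)"
    unfolding 1 2 by (simp only: mult_ac)
  also have "\<dots> = 1 * (?Y * ?Z)" unfolding 3 ..
  finally have "((schur_F oo schur_s) * ?f schur_F) * (?Y * ?Z) = 1 * (?Y * ?Z)" .
  moreover have "?Y * ?Z \<noteq> 0"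
  proof
    assume "?Y * ?Z = 0"
    then have "(?Y * ?Z) $ 0 = 0" by (simp only: fps_zero_nth)
    moreover have "(?Y * ?Z) $ 0 = 1" by (simp add: schur_S_def)
    ultimately show False by simp
  qed
  ultimately show ?thesis by (simp only: mult_cancel_right) simp
qed

section \<open>The transposed Casimir elements as polynomials in the Casimir elements\<close>

text \<open>Here shift_cas p stands for tr (E - N)^p and transp_cas p for tr E'^p, the trace of the p-th
  power of the transposed generator matrix; the recursion comes from E'^(p+1) = (E - N) E'^p + tr E'^p.\<close>

definition shift_cas :: "nat \<Rightarrow> mpoly" where
  "shift_cas p = (\<Sum>q\<le>p. of_nat (p choose q) * (- pN) ^ (p - q) * pvar q)"

fun transp_cas :: "nat \<Rightarrow> mpoly" where
  "transp_cas p = shift_cas p + (\<Sum>q<p. shift_cas (p - 1 - q) * transp_cas q)"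

declare transp_cas.simps [simp del]

text \<open>\<open>theta\<close> gives each letter a minus sign, whence (-1)^v. At v = 0 the value
  is N, the trace of the identity matrix, so the substitution by \<open>dual_img\<close> fixes
  N.\<close>

definition dual_img :: "nat \<Rightarrow> mpoly" where
  "dual_img v = (-1) ^ v * transp_cas v"

lemma dual_img_0: "dual_img 0 = pN"
  unfolding dual_img_def by (subst transp_cas.simps) (simp add: shift_cas_def)

text \<open>Pascal's rule, in the form m^(q+1) (1 - a X) = m^q X for m =
  \<open>mobius a\<close>.\<close>

lemma mobius_power_nth: "(mobius a ^ Suc q) $ Suc p = of_nat (p choose q) * a ^ (p - q)"
proof (induction p arbitrary: q)
  case 0
  have *: "mobius a ^ q * fps_X = mobius a ^ Suc q * (1 - fps_const a * fps_X)" for q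
    using mobius_eq[of a] by (simp add: mult.assoc mult.commute)
  have 0: "(mobius a ^ Suc q) $ 0 = 0" for q by simp
  have "(mobius a ^ q * fps_X) $ Suc 0 = (mobius a ^ Suc q) $ Suc 0 - (mobius a ^ Suc q) $ 0 * a"
    unfolding * by (simp add: right_diff_distrib mult.assoc[symmetric] del: power_Suc)
  then show ?case unfolding 0 by (cases q) (simp_all del: power_Suc, simp)
next
  case (Suc p)
  have *: "mobius a ^ q * fps_X = mobius a ^ Suc q * (1 - fps_const a * fps_X)" for q
    using mobius_eq[of a] by (simp add: mult.assoc mult.commute)
  have "(mobius a ^ q * fps_X) $ Suc (Suc p) = (mobius a ^ Suc q) $ Suc (Suc p) - (mobius a ^ Suc q) $ Suc p * a"
    unfolding * by (simp add: right_diff_distrib mult.assoc[symmetric] del: power_Suc)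
  then have "(mobius a ^ Suc q) $ Suc (Suc p) = (mobius a ^ q) $ Suc p + of_nat (p choose q) * a ^ (p - q) * a"
    unfolding Suc by (simp add: algebra_simps del: power_Suc)
  also have "\<dots> = of_nat (Suc p choose q) * a ^ (Suc p - q)"
  proof (cases q)
    case 0
    then show ?thesis by (simp add: mult.commute)
  next
    case (Suc r)
    have "of_nat (p choose Suc r) * a ^ (p - Suc r) * a = of_nat (p choose Suc r) * a ^ (p - r)"
      by (cases "Suc r \<le> p") (simp_all add: Suc_diff_Suc mult.assoc flip: power_Suc2)
    then show ?thesis unfolding Suc Suc.IH by (simp add: distrib_right)
  qed
  finally show ?case .
qed

abbreviation schur_img :: "nat \<Rightarrow> mpoly" where
  "schur_img \<equiv> (\<lambda>v. if v = 0 then pN else schur_C v)"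

lemma schur_F_nth: "schur_F $ 0 = 1" "schur_F $ Suc q = - schur_img q"
  by (simp_all add: schur_F_def)

text \<open>The coefficients of A(- u / (1 - N u)) are, up to sign, the images of
  \<open>shift_cas p\<close>, that is of tr (E - N)^p. The sign (-1)^(q+1) of the power of s and the
  sign (-1)^(p-q) from passing from N to -N combine to (-1)^(p+1) for every q, so they leave the
  sum.\<close>

lemma schur_F_compose_nth:
  "(schur_F oo schur_s) $ Suc p = (-1) ^ p * psubst schur_img (shift_cas p)"
proof -
  have s: "(schur_s ^ Suc q) $ Suc p = - ((-1) ^ p * (of_nat (p choose q) * (- pN) ^ (p - q)))"
    if "q \<le> p" for q
  proof -
    have "schur_s ^ Suc q = (-1) ^ Suc q * mobius pN ^ Suc q"
      unfolding schur_s_def by (rule power_minus)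
    then have "(schur_s ^ Suc q) $ Suc p = (-1) ^ Suc q * (mobius pN ^ Suc q) $ Suc p"
      by (cases "even q") (simp_all del: power_Suc add: minus_one_power_iff)
    also have "\<dots> = (-1) ^ Suc q * (of_nat (p choose q) * pN ^ (p - q))"
      unfolding mobius_power_nth ..
    also have "pN ^ (p - q) = (-1) ^ (p - q) * (- pN) ^ (p - q)"
      by (simp flip: power_mult_distrib)
    also have "(-1) ^ Suc q * (of_nat (p choose q) * ((-1) ^ (p - q) * (- pN) ^ (p - q))) =
        (-1) ^ (Suc q + (p - q)) * (of_nat (p choose q) * (- pN) ^ (p - q))"
      by (simp only: power_add mult_ac)
    also have "Suc q + (p - q) = Suc p" using that by simp
    finally show ?thesis by simp
  qed
  have "(schur_F oo schur_s) $ Suc p = (\<Sum>q\<le>p. schur_F $ Suc q * (schur_s ^ Suc q) $ Suc p)"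
    unfolding fps_compose_nth sum.atLeast0_atMost_Suc_shift by (simp add: atLeast0AtMost del: power_Suc)
  also have "\<dots> = (\<Sum>q\<le>p. (-1) ^ p * (of_nat (p choose q) * (- pN) ^ (p - q) * schur_img q))"
    by (intro sum.cong refl) (simp add: s schur_F_nth mult_ac del: power_Suc)
  finally show ?thesis
    by (simp add: shift_cas_def psubst_sum psubst_mult psubst_power psubst_uminus sum_distrib_left)
qed

text \<open>The recursion for \<open>transp_cas\<close> says that the series H is inverse to A o s.
  By \<open>schur_flip\<close> the sign-flipped A is an inverse as well, so the two agree
  coefficientwise.\<close>

lemma psubst_schur_dual:
  assumes "v \<ge> 1"
  shows "psubst schur_img (dual_img v) = psubst flip_img (schur_C v)"
proof -
  let ?b = "\<lambda>p. psubst schur_img (shift_cas p)" and ?c = "\<lambda>p. psubst schur_img (transp_cas p)"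
  define H where "H = Abs_fps (\<lambda>n. if n = 0 then 1 else (-1) ^ n * ?c (n - 1))"
  have H: "H $ 0 = 1" "H $ Suc n = (-1) ^ Suc n * ?c n" for n by (simp_all add: H_def)
  let ?G = "schur_F oo schur_s"
  have c: "?c p = ?b p + (\<Sum>q<p. ?b (p - 1 - q) * ?c q)" for p
    by (subst transp_cas.simps) (simp add: psubst_add psubst_sum psubst_mult)
  have "?G * H = 1"
  proof (rule fps_ext)
    fix n
    show "(?G * H) $ n = 1 $ n"
    proof (cases n)
      case 0
      then show ?thesis by (simp add: H schur_F_nth)
    next
      case (Suc p)
      have t: "?G $ (Suc p - Suc q) * H $ Suc q = - ((-1) ^ p * (- ?b (p - 1 - q) * ?c q))" if "q < p" for q
      proof -
        have "Suc p - Suc q = Suc (p - 1 - q)" using that by simp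
        then have "?G $ (Suc p - Suc q) * H $ Suc q = (-1) ^ (p - 1 - q + Suc q) * (?b (p - 1 - q) * ?c q)"
          unfolding H by (simp only: schur_F_compose_nth power_add mult_ac)
        also have "p - 1 - q + Suc q = p" using that by simp
        finally show ?thesis by simp
      qed
      have "(?G * H) $ Suc p = (\<Sum>i\<le>Suc p. ?G $ (Suc p - i) * H $ i)"
        unfolding mult.commute[of ?G] fps_mult_nth by (simp add: mult.commute atLeast0AtMost)
      also have "\<dots> = ?G $ Suc p * H $ 0 + (\<Sum>q\<le>p. ?G $ (Suc p - Suc q) * H $ Suc q)"
        by (subst sum.atMost_Suc_shift) simp
      also have "(\<Sum>q\<le>p. ?G $ (Suc p - Suc q) * H $ Suc q) =
          (\<Sum>q<p. ?G $ (Suc p - Suc q) * H $ Suc q) + ?G $ 0 * H $ Suc p"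
        by (subst lessThan_Suc_atMost[symmetric]) simp
      also have "(\<Sum>q<p. ?G $ (Suc p - Suc q) * H $ Suc q) = (-1) ^ p * (\<Sum>q<p. ?b (p - 1 - q) * ?c q)"
        unfolding sum_distrib_left by (intro sum.cong refl, subst t) simp_all
      also have "?G $ Suc p * H $ 0 + ((-1) ^ p * (\<Sum>q<p. ?b (p - 1 - q) * ?c q) + ?G $ 0 * H $ Suc p) =
          (-1) ^ p * (?b p + (\<Sum>q<p. ?b (p - 1 - q) * ?c q) - ?c p)"
        by (simp add: H schur_F_compose_nth schur_F_nth algebra_simps)
      also have "\<dots> = 0" unfolding c[of p, symmetric] by simp
      finally show ?thesis by (simp add: Suc)
    qed
  qed
  then have "?G * H = ?G * fps_psubst flip_img schur_F" by (simp only: schur_flip)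
  moreover have "?G \<noteq> 0"
    using schur_flip by fastforce
  ultimately have "H = fps_psubst flip_img schur_F" by (simp only: mult_cancel_left) simp
  then have "H $ Suc v = psubst flip_img (schur_F $ Suc v)" by simp
  then have "(-1) ^ Suc v * ?c v = - psubst flip_img (schur_C v)"
    unfolding H schur_F_nth using assms by (simp add: psubst_uminus)
  moreover have "psubst schur_img ((-1) ^ v) = (-1) ^ v"
    by (simp add: psubst_power psubst_uminus)
  ultimately show ?thesis
    unfolding dual_img_def psubst_mult by simp
qed

lemma schur_subst_dual: "schur_subst (psubst dual_img p) = sign_flip (schur_subst p)"
proof -
  have "(\<lambda>v. psubst schur_img (dual_img v)) = (\<lambda>v. psubst flip_img (schur_img v))"
  proof
    fix v
    show "psubst schur_img (dual_img v) = psubst flip_img (schur_img v)"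
      using psubst_schur_dual[of v] by (cases "v = 0") (simp_all add: dual_img_0)
  qed
  then show ?thesis unfolding schur_subst_def sign_flip_def psubst_psubst by simp
qed


section \<open>The automorphism sending E_ij to - E_ji\<close>

text \<open>The letters are transposed but keep their order, so this is an automorphism and not an
  anti-automorphism.\<close>

definition theta :: "nca \<Rightarrow> nca" where
  "theta a = (\<Sum>w\<in>Poly_Mapping.keys a. Poly_Mapping.single (map prod.swap w) ((-1) ^ length w * Poly_Mapping.lookup a w))"

lemma theta_add: "theta (a + b) = theta a + theta b"
  unfolding theta_def
  by (rule setsum_keys_plus_distrib) (simp_all add: single_add distrib_left)

lemma theta_single: "theta (Poly_Mapping.single w c) = Poly_Mapping.single (map prod.swap w) ((-1) ^ length w * c)"
  unfolding theta_def by simp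

lemma theta_0 [simp]: "theta 0 = 0"
  by (simp add: theta_def)

lemma theta_mult: "theta (a * b) = theta a * theta b"
proof (induction a rule: poly_mapping_induct_single)
  case (single u c)
  show ?case
  proof (induction b rule: poly_mapping_induct_single)
    case (single v d)
    show ?case by (simp add: mult_single theta_single plus_list_def power_add mult_ac)
  qed (simp_all add: theta_add distrib_left)
qed (simp_all add: theta_add distrib_right)

lemma theta_scal: "theta (scal c) = scal c"
  by (simp add: theta_single) (simp add: zero_list_def)

lemma theta_1 [simp]: "theta 1 = 1"
  using theta_scal[of 1] by simp

lemma theta_EE: "theta (EE i j) = - EE j i"
  by (simp add: theta_single single_uminus)

lemma theta_uminus: "theta (- a) = - theta a"
  using theta_add[of a "- a"] by (simp add: eq_neg_iff_add_eq_0 add.commute)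

lemma theta_diff: "theta (a - b) = theta a - theta b"
  using theta_add[of a "- b"] by (simp add: theta_uminus)

lemma theta_sum: "theta (sum f A) = (\<Sum>x\<in>A. theta (f x))"
  by (induction A rule: infinite_finite_induct) (simp_all add: theta_add)

lemma theta_power: "theta (a ^ n) = theta a ^ n"
  by (induction n) (simp_all add: theta_mult)

lemma theta_rel_elt: "theta (rel_elt i j k l) = rel_elt j i l k"
  by (auto simp: rel_elt_def theta_add theta_diff theta_mult theta_EE)

lemma theta_rel_ideal: "a \<in> rel_ideal N \<Longrightarrow> theta a \<in> rel_ideal N"
proof (induction rule: rel_ideal.induct)
  case (gen i j k l c u v)
  have "theta (scal c * (word u * (rel_elt i j k l * word v))) =
      scal c * (theta (word u) * (rel_elt j i l k * theta (word v)))"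
    by (simp only: theta_mult theta_scal theta_rel_elt)
  moreover have "rel_elt j i l k \<in> rel_ideal N"
    using rel_ideal.gen[of j N i l k 1 "[]" "[]"] gen by (simp add: word_Nil)
  ultimately show ?case
    by (simp only: rel_ideal_mult_left rel_ideal_mult_right)
qed (simp_all add: rel_ideal.zero rel_ideal.add theta_add)

lemma theta_cong: "a \<approx>\<^bsub>N\<^esub> b \<Longrightarrow> theta a \<approx>\<^bsub>N\<^esub> theta b"
  unfolding gl_cong_def theta_diff[symmetric] by (rule theta_rel_ideal)

text \<open>Entry (j, i) of the p-th power of the transposed matrix F with F_ij = E_ji, after the
  sign of \<open>theta\<close> is removed. The indices are exchanged so that the commutation rule
  has the same form as for E^p.\<close>

definition tpow :: "nat \<Rightarrow> nat \<Rightarrow> nat \<Rightarrow> nat \<Rightarrow> nca" where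
  "tpow N p i j = (-1) ^ p * theta (mpow N p j i)"

lemma tpow_0: "tpow N 0 i j = (if i = j then 1 else 0)"
  by (simp add: tpow_def)

lemma minus_one_power_commute: "(-1) ^ p * a = a * (-1) ^ p" for a :: "'a::ring_1"
  by (cases "even p") (simp_all add: minus_one_power_iff)

lemma tpow_Suc:
  assumes "i < N" "j < N"
  shows "tpow N (Suc p) i j = (\<Sum>k<N. tpow N p k j * EE i k)"
proof -
  have "theta (mpow N (Suc p) j i) = (\<Sum>k<N. - (theta (mpow N p j k) * EE i k))"
    unfolding mpow_Suc_right[OF assms(2,1)] by (simp add: theta_sum theta_mult theta_EE)
  then show ?thesis
    by (simp add: tpow_def sum_negf sum_distrib_left mult.assoc)
qed

lemma EE_tpow_commutator:
  assumes "i < N" "j < N" "k < N" "l < N"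
  shows "EE i j * tpow N p k l - tpow N p k l * EE i j
    \<approx>\<^bsub>N\<^esub> (if j = k then tpow N p i l else 0) - (if l = i then tpow N p k j else 0)"
proof -
  let ?s = "(-1) ^ p :: nca"
  have "theta (EE j i * mpow N p l k - mpow N p l k * EE j i)
     \<approx>\<^bsub>N\<^esub> theta ((if i = l then mpow N p j k else 0) - (if k = j then mpow N p l i else 0))"
    using assms by (intro theta_cong EE_mpow_commutator)
  then have "(- ?s) * theta (EE j i * mpow N p l k - mpow N p l k * EE j i)
     \<approx>\<^bsub>N\<^esub> (- ?s) * theta ((if i = l then mpow N p j k else 0) - (if k = j then mpow N p l i else 0))"
    by (rule gl_cong_mult_left)
  moreover have "(- ?s) * theta (EE j i * mpow N p l k - mpow N p l k * EE j i) =
      EE i j * tpow N p k l - tpow N p k l * EE i j"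
  proof -
    have "?s * (EE i j * theta (mpow N p l k)) = EE i j * (?s * theta (mpow N p l k))"
      unfolding mult.assoc[symmetric] minus_one_power_commute[of p "EE i j"] ..
    then show ?thesis
      by (simp add: theta_diff theta_mult theta_EE tpow_def right_diff_distrib mult.assoc)
  qed
  moreover have "(- ?s) * theta ((if i = l then mpow N p j k else 0) - (if k = j then mpow N p l i else 0)) =
      (if j = k then tpow N p i l else 0) - (if l = i then tpow N p k j else 0)"
    by (auto simp: theta_diff theta_uminus tpow_def right_diff_distrib)
  ultimately show ?thesis by simp
qed

text \<open>The new generator enters on the right of T = \<open>tpow N p\<close>. Moving it to the
  left costs the sum over k of [E_ik, T_kj], which is N T_ij minus tr T on the diagonal.\<close>

lemma tpow_Suc_cong:
  assumes "i < N" "j < N"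
  shows "tpow N (Suc p) i j \<approx>\<^bsub>N\<^esub> (\<Sum>k<N. EE i k * tpow N p k j) - scal (of_nat N) * tpow N p i j
           + (if i = j then (\<Sum>k<N. tpow N p k k) else 0)"
proof -
  have "tpow N (Suc p) i j =
      (\<Sum>k<N. EE i k * tpow N p k j) - (\<Sum>k<N. EE i k * tpow N p k j - tpow N p k j * EE i k)"
    unfolding tpow_Suc[OF assms] by (simp add: sum_subtractf)
  also have "\<dots> \<approx>\<^bsub>N\<^esub> (\<Sum>k<N. EE i k * tpow N p k j) -
      (\<Sum>k<N. (if k = k then tpow N p i j else 0) - (if j = i then tpow N p k k else 0))"
    using assms by (intro gl_cong_diff[OF gl_cong_refl] gl_cong_sum EE_tpow_commutator) auto
  also have "\<dots> = (\<Sum>k<N. EE i k * tpow N p k j) - scal (of_nat N) * tpow N p i j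
           + (if i = j then (\<Sum>k<N. tpow N p k k) else 0)"
    by (simp add: sum_subtractf)
  finally show ?thesis .
qed

text \<open>Entries of (E - N)^p, expanded by the binomial theorem so that their trace matches the
  specialisation of \<open>shift_cas\<close>.\<close>

definition kpow :: "nat \<Rightarrow> nat \<Rightarrow> nat \<Rightarrow> nat \<Rightarrow> nca" where
  "kpow N p i j = (\<Sum>q\<le>p. scal (of_nat (p choose q) * (- of_nat N) ^ (p - q)) * mpow N q i j)"

lemma binomial_shift:
  fixes f :: "nat \<Rightarrow> nca"
  shows "(\<Sum>q\<le>Suc p. scal (of_nat (Suc p choose q) * x ^ (Suc p - q)) * f q) =
     (\<Sum>q\<le>p. scal (of_nat (p choose q) * x ^ (p - q)) * f (Suc q)) +
     scal x * (\<Sum>q\<le>p. scal (of_nat (p choose q) * x ^ (p - q)) * f q)"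
proof -
  let ?t = "\<lambda>q. scal (of_nat (p choose q) * x ^ (Suc p - q)) * f q"
  have "scal x * (\<Sum>q\<le>p. scal (of_nat (p choose q) * x ^ (p - q)) * f q) = (\<Sum>q\<le>p. ?t q)"
    unfolding sum_distrib_left
  proof (intro sum.cong refl)
    fix q assume "q \<in> {..p}"
    then have "x * (of_nat (p choose q) * x ^ (p - q)) = of_nat (p choose q) * x ^ (Suc p - q)"
      by (simp add: Suc_diff_le)
    then show "scal x * (scal (of_nat (p choose q) * x ^ (p - q)) * f q) = ?t q"
      by (simp only: mult.assoc[symmetric] scal_mult[symmetric])
  qed
  also have "\<dots> = (\<Sum>q\<le>Suc p. ?t q)" by (simp add: binomial_eq_0)
  also have "\<dots> = ?t 0 + (\<Sum>q\<le>p. ?t (Suc q))" by (rule sum.atMost_Suc_shift)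
  finally have "scal x * (\<Sum>q\<le>p. scal (of_nat (p choose q) * x ^ (p - q)) * f q) = ?t 0 + (\<Sum>q\<le>p. ?t (Suc q))" .
  moreover have "(\<Sum>q\<le>Suc p. scal (of_nat (Suc p choose q) * x ^ (Suc p - q)) * f q) =
     ?t 0 + (\<Sum>q\<le>p. scal (of_nat (p choose q) * x ^ (p - q)) * f (Suc q) + ?t (Suc q))"
    unfolding sum.atMost_Suc_shift by (simp add: distrib_right single_add)
  ultimately show ?thesis by (simp add: sum.distrib algebra_simps)
qed

lemma kpow_0: "kpow N 0 i j = (if i = j then 1 else 0)"
  by (simp add: kpow_def)

lemma kpow_Suc: "kpow N (Suc p) i j = (\<Sum>k<N. EE i k * kpow N p k j) - scal (of_nat N) * kpow N p i j"
proof -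
  let ?k = "\<lambda>q. scal (of_nat (p choose q) * (- of_nat N) ^ (p - q))"
  have "kpow N (Suc p) i j = (\<Sum>q\<le>p. ?k q * mpow N (Suc q) i j) - scal (of_nat N) * kpow N p i j"
    unfolding kpow_def binomial_shift by (simp add: single_uminus)
  also have "(\<Sum>q\<le>p. ?k q * mpow N (Suc q) i j) = (\<Sum>q\<le>p. \<Sum>k<N. EE i k * (?k q * mpow N q k j))"
    unfolding mpow.simps sum_distrib_left
    by (intro sum.cong refl) (simp only: mult.assoc[symmetric] scal_commute[of _ "EE i _"])
  also have "\<dots> = (\<Sum>k<N. EE i k * kpow N p k j)"
    unfolding kpow_def sum_distrib_left by (rule sum.swap)
  finally show ?thesis .
qed

text \<open>Variation of constants for the affine recursion \<open>tpow_Suc_cong\<close>: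
  \<open>kpow\<close> solves the homogeneous part and each trace acts as an inhomogeneity. The
  diagonal term of the induction step becomes the summand q = p, since \<open>kpow N 0\<close> is
  the identity matrix.\<close>

lemma tpow_cong_kpow:
  assumes "i < N" "j < N"
  shows "tpow N p i j \<approx>\<^bsub>N\<^esub> kpow N p i j + (\<Sum>q<p. kpow N (p - 1 - q) i j * (\<Sum>k<N. tpow N q k k))"
  using assms(1)
proof (induction p arbitrary: i)
  case 0
  show ?case by (simp add: tpow_0 kpow_0)
next
  case (Suc p)
  let ?t = "\<lambda>q. \<Sum>k<N. tpow N q k k"
  let ?R = "\<lambda>i. kpow N p i j + (\<Sum>q<p. kpow N (p - 1 - q) i j * ?t q)"
  have "tpow N (Suc p) i j \<approx>\<^bsub>N\<^esub> (\<Sum>k<N. EE i k * tpow N p k j) - scal (of_nat N) * tpow N p i j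
           + (if i = j then ?t p else 0)"
    using Suc.prems assms(2) by (rule tpow_Suc_cong)
  also have "\<dots> \<approx>\<^bsub>N\<^esub> (\<Sum>k<N. EE i k * ?R k) - scal (of_nat N) * ?R i + (if i = j then ?t p else 0)"
    using Suc.IH Suc.prems by (intro gl_cong_add[OF _ gl_cong_refl] gl_cong_diff gl_cong_sum gl_cong_mult_left) auto
  also have "\<dots> = kpow N (Suc p) i j + (\<Sum>q<Suc p. kpow N (Suc p - 1 - q) i j * ?t q)"
  proof -
    have "(\<Sum>k<N. EE i k * (\<Sum>q<p. kpow N (p - 1 - q) k j * ?t q)) =
        (\<Sum>q<p. (\<Sum>k<N. EE i k * kpow N (p - 1 - q) k j) * ?t q)"
      unfolding sum_distrib_left[of "EE _ _"] sum_distrib_right[of _ _ "?t _"] mult.assoc by (rule sum.swap)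
    then have "(\<Sum>k<N. EE i k * ?R k) - scal (of_nat N) * ?R i =
        ((\<Sum>k<N. EE i k * kpow N p k j) - scal (of_nat N) * kpow N p i j) +
        (\<Sum>q<p. ((\<Sum>k<N. EE i k * kpow N (p - 1 - q) k j) - scal (of_nat N) * kpow N (p - 1 - q) i j) * ?t q)"
      unfolding left_diff_distrib sum_subtractf distrib_left sum.distrib
      unfolding sum_distrib_left[of "scal _"] mult.assoc by (simp add: algebra_simps)
    also have "\<dots> = kpow N (Suc p) i j + (\<Sum>q<p. kpow N (p - q) i j * ?t q)"
      unfolding kpow_Suc[symmetric] by (intro arg_cong2[where f = "(+)"] sum.cong refl) (simp add: Suc_diff_Suc)
    finally show ?thesis by (simp add: kpow_0)
  qed
  finally show ?case .
qed

section \<open>Specialisation of the transposed Casimir polynomials\<close>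

lemma scal_power: "scal a ^ n = scal (a ^ n)"
  by (induction n) (simp_all add: mult_single)

lemma spec_of_nat: "spec N (of_nat n) = scal (of_nat n)"
  using spec_pconst[of N "of_nat n"] by (simp only: pconst_def single_of_nat)

lemma spec_scal_mult: "spec N (of_nat a * (- pN) ^ k * p) \<approx>\<^bsub>N\<^esub> scal (of_nat a * (- of_nat N) ^ k) * spec N p"
proof -
  have "spec N (of_nat a * (- pN) ^ k * p) \<approx>\<^bsub>N\<^esub> spec N (of_nat a * (- pN) ^ k) * spec N p"
    by (rule spec_mult)
  also have "\<dots> \<approx>\<^bsub>N\<^esub> spec N (of_nat a) * spec N ((- pN) ^ k) * spec N p"
    by (rule gl_cong_mult_right, rule spec_mult)
  also have "\<dots> \<approx>\<^bsub>N\<^esub> spec N (of_nat a) * (spec N (- pN)) ^ k * spec N p"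
    by (rule gl_cong_mult_right, rule gl_cong_mult_left, rule spec_power)
  also have "\<dots> = scal (of_nat a * (- of_nat N) ^ k) * spec N p"
    by (simp only: spec_of_nat spec_uminus spec_pN single_uminus[symmetric] scal_power scal_mult)
  finally show ?thesis .
qed

text \<open>Here N takes the place of C_0 = tr E^0.\<close>

lemma spec_pvar_trace: "spec N (pvar q) = (\<Sum>i<N. mpow N q i i)"
  by (cases "q = 0") (simp_all add: spec_pN spec_pvar casim_eq_trace)

lemma spec_shift_cas: "spec N (shift_cas p) \<approx>\<^bsub>N\<^esub> (\<Sum>i<N. kpow N p i i)"
proof -
  have "spec N (shift_cas p) \<approx>\<^bsub>N\<^esub>
      (\<Sum>q\<le>p. scal (of_nat (p choose q) * (- of_nat N) ^ (p - q)) * (\<Sum>i<N. mpow N q i i))"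
    unfolding shift_cas_def spec_sum spec_pvar_trace[symmetric]
    by (intro gl_cong_sum spec_scal_mult)
  also have "\<dots> = (\<Sum>i<N. kpow N p i i)"
    unfolding kpow_def sum_distrib_left by (rule sum.swap)
  finally show ?thesis .
qed

text \<open>The trace of \<open>tpow_cong_kpow\<close> reproduces the recursion that defines
  \<open>transp_cas\<close>.\<close>

lemma spec_transp_cas: "spec N (transp_cas p) \<approx>\<^bsub>N\<^esub> (\<Sum>i<N. tpow N p i i)"
proof (induction p rule: less_induct)
  case (less p)
  let ?t = "\<lambda>q. \<Sum>k<N. tpow N q k k"
  have "spec N (transp_cas p) = spec N (shift_cas p) + (\<Sum>q<p. spec N (shift_cas (p - 1 - q) * transp_cas q))"
    by (subst transp_cas.simps) (simp add: spec_add spec_sum)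
  also have "\<dots> \<approx>\<^bsub>N\<^esub> (\<Sum>i<N. kpow N p i i) + (\<Sum>q<p. (\<Sum>i<N. kpow N (p - 1 - q) i i) * ?t q)"
    by (intro gl_cong_add gl_cong_sum spec_shift_cas gl_cong_trans[OF spec_mult] gl_cong_mult less) auto
  also have "\<dots> = (\<Sum>i<N. kpow N p i i + (\<Sum>q<p. kpow N (p - 1 - q) i i * ?t q))"
    unfolding sum.distrib sum_distrib_right[of _ _ "?t _"] by (subst sum.swap) simp
  also have "\<dots> \<approx>\<^bsub>N\<^esub> ?t p"
    by (intro gl_cong_sum gl_cong_sym[OF tpow_cong_kpow]) auto
  finally show ?case .
qed

lemma theta_casim:
  assumes "k \<ge> 1"
  shows "theta (casim N k) \<approx>\<^bsub>N\<^esub> spec N (dual_img k)"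
proof -
  have s: "spec N ((-1) ^ k * p) = (-1) ^ k * spec N p" for p
    by (cases "even k") (simp_all add: minus_one_power_iff spec_uminus)
  have "spec N (dual_img k) \<approx>\<^bsub>N\<^esub> (-1) ^ k * (\<Sum>i<N. tpow N k i i)"
    unfolding dual_img_def s by (rule gl_cong_mult_left, rule spec_transp_cas)
  also have "\<dots> = theta (casim N k)"
    unfolding tpow_def casim_eq_trace[OF assms] theta_sum sum_distrib_left
    by (intro sum.cong refl) (simp add: mult.assoc[symmetric] flip: power_add mult_2)
  finally show ?thesis by (rule gl_cong_sym)
qed

lemma theta_cmon:
  assumes "0 \<notin> set ks" "distinct ks"
  shows "theta (cmon N e ks) \<approx>\<^bsub>N\<^esub> spec N (\<Prod>v\<in>set ks. dual_img v ^ e v)"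
  using assms
proof (induction ks)
  case (Cons k ks)
  have "theta (cmon N e (k # ks)) = theta (casim N k) ^ e k * theta (cmon N e ks)"
    by (simp add: theta_mult theta_power)
  also have "\<dots> \<approx>\<^bsub>N\<^esub> spec N (dual_img k) ^ e k * spec N (\<Prod>v\<in>set ks. dual_img v ^ e v)"
    using Cons by (intro gl_cong_mult gl_cong_power theta_casim) auto
  also have "\<dots> \<approx>\<^bsub>N\<^esub> spec N (dual_img k ^ e k) * spec N (\<Prod>v\<in>set ks. dual_img v ^ e v)"
    by (intro gl_cong_mult_right gl_cong_sym[OF spec_power])
  also have "\<dots> \<approx>\<^bsub>N\<^esub> spec N (dual_img k ^ e k * (\<Prod>v\<in>set ks. dual_img v ^ e v))"
    by (rule gl_cong_sym[OF spec_mult])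
  also have "\<dots> = spec N (\<Prod>v\<in>set (k # ks). dual_img v ^ e v)" using Cons.prems by simp
  finally show ?case .
qed simp

lemma theta_spec: "theta (spec N p) \<approx>\<^bsub>N\<^esub> spec N (psubst dual_img p)"
proof (induction p rule: poly_mapping_induct_single)
  case (single mo c)
  let ?K = "Poly_Mapping.keys mo" and ?l = "Poly_Mapping.lookup mo"
  let ?ks = "sorted_list_of_set (?K - {0})"
  have ks: "set ?ks = ?K - {0}" by simp
  let ?P = "\<Prod>v\<in>set ?ks. dual_img v ^ ?l v"
  have "theta (spec N (Poly_Mapping.single mo c)) = scal (c * of_nat N ^ ?l 0) * theta (cmon N ?l ?ks)"
    by (simp only: spec_single theta_mult theta_scal)
  also have "\<dots> \<approx>\<^bsub>N\<^esub> scal (c * of_nat N ^ ?l 0) * spec N ?P"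
    by (intro gl_cong_mult_left theta_cmon) auto
  also have "\<dots> = spec N (pconst c) * spec N pN ^ ?l 0 * spec N ?P"
    by (simp only: spec_pconst spec_pN scal_power scal_mult)
  also have "\<dots> \<approx>\<^bsub>N\<^esub> spec N (pconst c) * spec N (pN ^ ?l 0) * spec N ?P"
    by (intro gl_cong_mult_right gl_cong_mult_left gl_cong_sym[OF spec_power])
  also have "\<dots> \<approx>\<^bsub>N\<^esub> spec N (pconst c * pN ^ ?l 0) * spec N ?P"
    by (intro gl_cong_mult_right gl_cong_sym[OF spec_mult])
  also have "\<dots> \<approx>\<^bsub>N\<^esub> spec N (pconst c * pN ^ ?l 0 * ?P)"
    by (rule gl_cong_sym[OF spec_mult])
  also have "pconst c * pN ^ ?l 0 * ?P = psubst dual_img (Poly_Mapping.single mo c)"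
  proof -
    have "(\<Prod>v\<in>?K. dual_img v ^ ?l v) = (\<Prod>v\<in>insert 0 (?K - {0}). dual_img v ^ ?l v)"
      by (rule prod_keys_superset) auto
    also have "\<dots> = pN ^ ?l 0 * ?P" unfolding ks by (subst prod.insert) (simp_all add: dual_img_0)
    finally show ?thesis by (simp add: psubst_single mult.assoc)
  qed
  finally show ?case .
qed (auto simp: theta_add spec_add psubst_add intro: gl_cong_add)

section \<open>The automorphism on permutation words\<close>

definition wperm :: "nat \<Rightarrow> nat \<Rightarrow> (nat \<Rightarrow> nat) \<Rightarrow> nca" where
  "wperm N m \<alpha> = (\<Sum>i\<in>{0..<m} \<rightarrow>\<^sub>E {0..<N}. word (map (\<lambda>s. (i s, i (\<alpha> s))) [0..<m]))"

lemma lookup_wperm: "Poly_Mapping.lookup (wperm N m \<alpha>) = w_glN N m \<alpha>"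
  by (simp add: wperm_def w_glN_def lookup_nca_sum lookup_word)

text \<open>Transposition turns the letters into (i (\<alpha> s), i s). With i o \<alpha> as the new
  index function j they read (j s, j (inv \<alpha> s)); \<open>restrict\<close> keeps the functions
  extensional.\<close>

lemma theta_wperm:
  assumes "\<alpha> permutes {0..<m}"
  shows "theta (wperm N m \<alpha>) = (-1) ^ m * wperm N m (inv \<alpha>)"
proof -
  have th: "theta (word (map (\<lambda>s. (i s, i (\<alpha> s))) [0..<m])) = (-1) ^ m * word (map (\<lambda>s. (i (\<alpha> s), i s)) [0..<m])" for i
    by (cases "even m") (simp_all add: theta_single comp_def minus_one_power_iff single_uminus)
  have ia: "inv \<alpha> permutes {0..<m}" using assms by (rule permutes_inv)
  have inv: "\<alpha> (inv \<alpha> s) = s" "inv \<alpha> (\<alpha> s) = s" for s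
    using permutes_inverses[OF assms] by auto
  have lt: "\<alpha> s < m \<longleftrightarrow> s < m" "inv \<alpha> s < m \<longleftrightarrow> s < m" for s
    using permutes_in_image[OF assms, of s] permutes_in_image[OF ia, of s] by auto
  have "(\<Sum>i\<in>{0..<m} \<rightarrow>\<^sub>E {0..<N}. word (map (\<lambda>s. (i (\<alpha> s), i s)) [0..<m])) = wperm N m (inv \<alpha>)"
    unfolding wperm_def
  proof (rule sum.reindex_bij_witness[where i = "\<lambda>i. restrict (\<lambda>s. i (inv \<alpha> s)) {0..<m}"
        and j = "\<lambda>i. restrict (\<lambda>s. i (\<alpha> s)) {0..<m}"])
    fix i assume i: "i \<in> {0..<m} \<rightarrow>\<^sub>E {0..<N}"
    show "restrict (\<lambda>s. restrict (\<lambda>s. i (\<alpha> s)) {0..<m} (inv \<alpha> s)) {0..<m} = i"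
      using PiE_arb[OF i] by (auto simp: fun_eq_iff restrict_def inv lt)
    show "restrict (\<lambda>s. restrict (\<lambda>s. i (inv \<alpha> s)) {0..<m} (\<alpha> s)) {0..<m} = i"
      using PiE_arb[OF i] by (auto simp: fun_eq_iff restrict_def inv lt)
    show "restrict (\<lambda>s. i (\<alpha> s)) {0..<m} \<in> {0..<m} \<rightarrow>\<^sub>E {0..<N}"
      using PiE_mem[OF i] by (auto simp: lt)
    show "restrict (\<lambda>s. i (inv \<alpha> s)) {0..<m} \<in> {0..<m} \<rightarrow>\<^sub>E {0..<N}"
      using PiE_mem[OF i] by (auto simp: lt)
    show "word (map (\<lambda>s. (restrict (\<lambda>s. i (\<alpha> s)) {0..<m} s, restrict (\<lambda>s. i (\<alpha> s)) {0..<m} (inv \<alpha> s))) [0..<m]) =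
        word (map (\<lambda>s. (i (\<alpha> s), i s)) [0..<m])"
      by (intro arg_cong[where f = word] map_cong) (auto simp: inv lt)
  qed
  then show ?thesis
    unfolding wperm_def[of N m \<alpha>] theta_sum th sum_distrib_left[symmetric] by simp
qed

section \<open>Existence of the universal weight system\<close>

text \<open>A permutation with an ordering of its domain is encoded as the list of pairs (s, \<alpha> s); unlike
  permutations of an initial segment, such lists can be merged and split without renumbering.\<close>

definition diag :: "(nat \<times> nat) list \<Rightarrow> bool" where
  "diag ps \<longleftrightarrow> distinct (map fst ps) \<and> distinct (map snd ps) \<and> set (map snd ps) = set (map fst ps)"

definition wdiag :: "nat \<Rightarrow> (nat \<times> nat) list \<Rightarrow> nca" where
  "wdiag N ps = (\<Sum>i\<in>set (map fst ps) \<rightarrow>\<^sub>E {0..<N}. word (map (map_prod i i) ps))"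

lemma diag_alt:
  "diag ps \<longleftrightarrow> distinct ps \<and> inj_on fst (set ps) \<and> inj_on snd (set ps) \<and> snd ` set ps = fst ` set ps"
  by (auto simp: diag_def distinct_map)

lemma diag_mset: "mset ps = mset qs \<Longrightarrow> diag ps \<longleftrightarrow> diag qs"
  unfolding diag_alt using mset_eq_imp_distinct_iff mset_eq_setD by metis

lemma map_map_prod_cong:
  assumes "\<And>x. x \<in> set (map fst ps) \<union> set (map snd ps) \<Longrightarrow> f x = g x"
  shows "map (map_prod f f) ps = map (map_prod g g) ps"
  using assms by (force intro: map_cong)

text \<open>The commutator term that arises when the adjacent letters E_(i_a i_b) and E_(i_c i_d) are swapped.\<close>

definition contr :: "nat \<Rightarrow> (nat \<times> nat) list \<Rightarrow> nat \<times> nat \<Rightarrow> nat \<times> nat \<Rightarrow> (nat \<times> nat) list \<Rightarrow> nca" where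
  "contr N u x y v = (\<Sum>i\<in>set (map fst (u @ [x, y] @ v)) \<rightarrow>\<^sub>E {0..<N}.
     if i (snd x) = i (fst y) then word (map (map_prod i i) (u @ [(fst x, snd y)] @ v)) else 0)"

text \<open>The relation of gl(N) for neighbouring letters (a, b) and (c, d). The contraction at i_b
  = i_c leaves E_(i_a i_d), the one at i_d = i_a leaves E_(i_c i_b), which is \<open>contr\<close>
  with x and y exchanged.\<close>

lemma wdiag_swap:
  assumes "diag (u @ [x, y] @ v)"
  shows "wdiag N (u @ [x, y] @ v) - wdiag N (u @ [y, x] @ v) \<approx>\<^bsub>N\<^esub> contr N u x y v - contr N u y x v"
proof -
  obtain a b where x: "x = (a, b)" by (cases x)
  obtain c d where y: "y = (c, d)" by (cases y)
  let ?V = "set (map fst (u @ [x, y] @ v))"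
  have V: "set (map fst (u @ [y, x] @ v)) = ?V" by auto
  have mem: "a \<in> ?V" "b \<in> ?V" "c \<in> ?V" "d \<in> ?V"
  proof -
    have "set (map snd (u @ [x, y] @ v)) = ?V" using assms by (simp only: diag_def)
    then show "a \<in> ?V" "b \<in> ?V" "c \<in> ?V" "d \<in> ?V" by (auto simp: x y)
  qed
  have w: "word (map (map_prod i i) (u @ [(p, q), (r, s)] @ v)) =
     word (map (map_prod i i) u) * (EE (i p) (i q) * EE (i r) (i s)) * word (map (map_prod i i) v)" for i p q r s
    using word_Cons[of "i p" "i q" "(i r, i s) # map (map_prod i i) v"] word_Cons[of "i r" "i s" "map (map_prod i i) v"]
    by (simp only: map_append word_append list.map map_prod_simp append.simps mult.assoc)
  have w1: "word (map (map_prod i i) (u @ [(p, q)] @ v)) =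
     word (map (map_prod i i) u) * EE (i p) (i q) * word (map (map_prod i i) v)" for i p q
    using word_Cons[of "i p" "i q" "map (map_prod i i) v"]
    by (simp only: map_append word_append list.map map_prod_simp append.simps mult.assoc)
  have "wdiag N (u @ [x, y] @ v) - wdiag N (u @ [y, x] @ v) =
    (\<Sum>i\<in>?V \<rightarrow>\<^sub>E {0..<N}. word (map (map_prod i i) u) *
       (EE (i a) (i b) * EE (i c) (i d) - EE (i c) (i d) * EE (i a) (i b)) * word (map (map_prod i i) v))"
    unfolding wdiag_def V sum_subtractf[symmetric] unfolding x y w
    by (simp only: left_diff_distrib right_diff_distrib)
  also have "\<dots> \<approx>\<^bsub>N\<^esub> (\<Sum>i\<in>?V \<rightarrow>\<^sub>E {0..<N}. word (map (map_prod i i) u) *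
       ((if i b = i c then EE (i a) (i d) else 0) - (if i d = i a then EE (i c) (i b) else 0)) * word (map (map_prod i i) v))"
  proof (intro gl_cong_sum gl_cong_mult_right gl_cong_mult_left EE_commutator)
    fix i assume i: "i \<in> ?V \<rightarrow>\<^sub>E {0..<N}"
    show "i a < N" "i b < N" "i c < N" "i d < N"
      using mem[THEN PiE_mem[OF i]] by auto
  qed
  also have "\<dots> = contr N u x y v - contr N u y x v"
    unfolding contr_def V sum_subtractf[symmetric] unfolding x y fst_conv snd_conv w1
    by (intro sum.cong refl) (simp add: left_diff_distrib right_diff_distrib)
  finally show ?thesis .
qed

text \<open>Under i_b = i_c the pairs (a, b), (c, d) collapse to (a, d) and the label c disappears:
  any remaining arrow into c is redirected to b. The list becomes one pair shorter.\<close>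

definition merge :: "(nat \<times> nat) list \<Rightarrow> nat \<times> nat \<Rightarrow> nat \<times> nat \<Rightarrow> (nat \<times> nat) list \<Rightarrow> (nat \<times> nat) list" where
  "merge u x y v = map (map_prod id (\<lambda>s. if s = fst y then snd x else s)) (u @ [(fst x, snd y)] @ v)"

text \<open>The second components run through the label set without b; redirecting c to b turns it
  into the label set without c, also when b = c.\<close>

lemma diag_merge:
  assumes "diag (u @ [x, y] @ v)"
  shows "diag (merge u x y v)"
    and "set (map fst (merge u x y v)) = set (map fst (u @ [x, y] @ v)) - {fst y}"
proof -
  obtain a b where x: "x = (a, b)" by (cases x)
  obtain c d where y: "y = (c, d)" by (cases y)
  let ?f = "\<lambda>s. if s = c then b else s"
  let ?V = "set (map fst (u @ [x, y] @ v))"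
  let ?R = "map snd u @ [d] @ map snd v"
  have F: "map fst (merge u x y v) = map fst u @ [a] @ map fst v"
    by (simp add: merge_def x y)
  have S: "map snd (merge u x y v) = map ?f ?R"
    by (simp add: merge_def x y)
  have 1: "distinct (map fst u @ [a, c] @ map fst v)" and 2: "distinct (map snd u @ [b, d] @ map snd v)"
    and 3: "set (map snd u @ [b, d] @ map snd v) = ?V"
    using assms by (simp_all add: diag_def x y)
  show F': "set (map fst (merge u x y v)) = ?V - {fst y}"
    unfolding F using 1 by (auto simp: x y)
  have R: "set ?R = ?V - {b}" "b \<in> ?V" unfolding 3[symmetric] using 2 by auto
  have cV: "c \<in> ?V" by (simp add: y)
  have "set (map ?f ?R) = ?f ` (?V - {b})" by (subst set_map, subst R(1)) (rule refl)
  also have "\<dots> = ?V - {c}"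
    using R(2) cV by (cases "b = c") (auto simp: image_iff)
  finally have "set (map snd (merge u x y v)) = set (map fst (merge u x y v))"
    unfolding S F' by (simp only: y fst_conv)
  moreover have "distinct (map ?f ?R)"
    unfolding distinct_map R using 2 by (auto simp: inj_on_def)
  ultimately show "diag (merge u x y v)"
    unfolding diag_def F using 1 S by auto
qed

lemma sum_PiE_insert_const:
  fixes g :: "(nat \<Rightarrow> nat) \<Rightarrow> nca"
  assumes "b \<notin> V" "\<And>i y. g (i(b := y)) = g i"
  shows "(\<Sum>i\<in>insert b V \<rightarrow>\<^sub>E {0..<N}. g i) = scal (of_nat N) * (\<Sum>i\<in>V \<rightarrow>\<^sub>E {0..<N}. g i)"
proof -
  have "(\<Sum>i\<in>insert b V \<rightarrow>\<^sub>E {0..<N}. g i) = (\<Sum>(y, i)\<in>{0..<N} \<times> (V \<rightarrow>\<^sub>E {0..<N}). g (i(b := y)))"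
    unfolding PiE_insert_eq
    by (subst sum.reindex[OF inj_combinator[OF assms(1)]]) (simp add: case_prod_unfold comp_def)
  also have "\<dots> = (\<Sum>y\<in>{0..<N}. \<Sum>i\<in>V \<rightarrow>\<^sub>E {0..<N}. g i)"
    unfolding sum.cartesian_product by (simp add: assms(2))
  finally show ?thesis by simp
qed

text \<open>If b = c, the constraint i_b = i_c is vacuous and c occurs in no remaining letter, so
  its index is free and contributes N. Otherwise the constraint determines i_c from i_b.\<close>

lemma contr_eq:
  assumes "diag (u @ [x, y] @ v)"
  shows "contr N u x y v = (if snd x = fst y then scal (of_nat N) else 1) * wdiag N (merge u x y v)"
proof -
  obtain a b where x: "x = (a, b)" by (cases x)
  obtain c d where y: "y = (c, d)" by (cases y)
  let ?V = "set (map fst (u @ [x, y] @ v))"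
  let ?q = "u @ [(a, d)] @ v"
  note M = diag_merge[OF assms]
  have bV: "b \<in> ?V" and cV: "c \<in> ?V" and qV: "set (map fst ?q) \<subseteq> ?V" "set (map snd ?q) \<subseteq> ?V"
  proof -
    have 3: "set (map snd (u @ [x, y] @ v)) = ?V" using assms by (simp only: diag_def)
    show "c \<in> ?V" "set (map fst ?q) \<subseteq> ?V" by (auto simp: x y)
    show "b \<in> ?V" "set (map snd ?q) \<subseteq> ?V" unfolding 3[symmetric] by (auto simp: x y)
  qed
  show ?thesis
  proof (cases "b = c")
    case True
    have mq: "merge u x y v = ?q"
    proof -
      have "map_prod id (\<lambda>s. if s = c then c else s) = (id :: nat \<times> nat \<Rightarrow> _)" by (auto simp: fun_eq_iff)
      then show ?thesis unfolding merge_def x y fst_conv snd_conv True by (simp only: list.map_id id_apply)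
    qed
    have cn: "c \<notin> set (map fst ?q) \<union> set (map snd ?q)"
      using M unfolding mq diag_def by (simp add: y)
    have V: "?V = insert c (set (map fst ?q))" by (auto simp: x y)
    have upd: "map (map_prod (i(c := z)) (i(c := z))) ?q = map (map_prod i i) ?q" for i z
      using cn by (intro map_map_prod_cong) auto
    have "(\<Sum>i\<in>insert c (set (map fst ?q)) \<rightarrow>\<^sub>E {0..<N}. word (map (map_prod i i) ?q)) =
        scal (of_nat N) * (\<Sum>i\<in>set (map fst ?q) \<rightarrow>\<^sub>E {0..<N}. word (map (map_prod i i) ?q))"
    proof (rule sum_PiE_insert_const)
      show "c \<notin> set (map fst ?q)" using cn by blast
    qed (simp only: upd)
    then show ?thesis
      unfolding contr_def V wdiag_def mq by (simp add: x y True)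
  next
    case False
    let ?V' = "?V - {c}"
    have m: "map (map_prod i i) (merge u x y v) = map (map_prod j j) ?q"
      if jb: "j b = j c" and ij: "\<And>s. s \<in> ?V' \<Longrightarrow> i s = j s" for i j :: "nat \<Rightarrow> nat"
    proof -
      have "map_prod i i (map_prod id (\<lambda>s. if s = c then b else s) p) = map_prod j j p" if p: "p \<in> set ?q" for p
      proof -
        have "fst p \<in> set (map fst (merge u x y v))"
          using p by (auto simp: merge_def x y)
        then have "fst p \<in> ?V'" unfolding M(2) by (simp only: y fst_conv)
        then have 1: "i (fst p) = j (fst p)" by (rule ij)
        have "snd p \<in> set (map snd ?q)" using p by (simp only: set_map imageI)
        then have "snd p \<in> ?V" using qV(2) by blast
        then have 2: "i (if snd p = c then b else snd p) = j (snd p)"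
          using bV False ij[of b] ij[of "snd p"] jb by (cases "snd p = c") simp_all
        show ?thesis using 1 2 by (simp add: map_prod_def case_prod_unfold)
      qed
      then show ?thesis unfolding merge_def x y fst_conv snd_conv map_map comp_def by (intro map_cong refl)
    qed
    have "contr N u x y v = (\<Sum>i\<in>{i \<in> ?V \<rightarrow>\<^sub>E {0..<N}. i b = i c}. word (map (map_prod i i) ?q))"
      unfolding contr_def x y fst_conv snd_conv
      by (subst sum.inter_filter) (simp_all add: finite_PiE)
    also have "\<dots> = (\<Sum>i\<in>?V' \<rightarrow>\<^sub>E {0..<N}. word (map (map_prod i i) (merge u x y v)))"
    proof (rule sum.reindex_bij_witness[where j = "\<lambda>i. restrict i ?V'" and i = "\<lambda>j. j(c := j b)"])
      fix i assume i: "i \<in> {i \<in> ?V \<rightarrow>\<^sub>E {0..<N}. i b = i c}"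
      then have ii: "i \<in> ?V \<rightarrow>\<^sub>E {0..<N}" "i b = i c" by auto
      show "(restrict i ?V')(c := restrict i ?V' b) = i"
        using ii(2) bV False PiE_arb[OF ii(1)] by (auto simp: fun_eq_iff restrict_def)
      show "restrict i ?V' \<in> ?V' \<rightarrow>\<^sub>E {0..<N}" using PiE_mem[OF ii(1)] by auto
      show "word (map (map_prod (restrict i ?V') (restrict i ?V')) (merge u x y v)) = word (map (map_prod i i) ?q)"
        using ii by (intro arg_cong[where f = word] m) auto
    next
      fix j assume j: "j \<in> ?V' \<rightarrow>\<^sub>E {0..<N}"
      show "restrict (j(c := j b)) ?V' = j"
        using PiE_arb[OF j] by (auto simp: fun_eq_iff restrict_def)
      show "j(c := j b) \<in> {i \<in> ?V \<rightarrow>\<^sub>E {0..<N}. i b = i c}"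
      proof -
        have "j(c := j b) \<in> insert c ?V' \<rightarrow>\<^sub>E {0..<N}"
          using bV False by (intro PiE_fun_upd j PiE_mem[OF j]) auto
        also have "insert c ?V' = ?V" using cV by auto
        finally have "j(c := j b) \<in> ?V \<rightarrow>\<^sub>E {0..<N}" .
        moreover have "(j(c := j b)) b = (j(c := j b)) c" using False by simp
        ultimately show ?thesis by blast
      qed
    qed
    also have "\<dots> = wdiag N (merge u x y v)"
      unfolding wdiag_def M(2) by (simp only: y fst_conv)
    finally show ?thesis using False by (simp add: x y)
  qed
qed

lemma wdiag_cycle:
  assumes "distinct cs"
  shows "wdiag N (zip cs (rotate1 cs)) = casim N (length cs)"
proof -
  have "map (map_prod i i) (zip cs (rotate1 cs)) = zip (map i cs) (rotate1 (map i cs))" for i :: "nat \<Rightarrow> nat"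
    by (simp add: zip_map_map rotate1_map map_prod_def)
  then have "wdiag N (zip cs (rotate1 cs)) =
      (\<Sum>i\<in>set cs \<rightarrow>\<^sub>E {0..<N}. word (zip (map i cs) (rotate1 (map i cs))))"
    by (simp only: wdiag_def map_fst_zip length_rotate1)
  also have "\<dots> = (\<Sum>xs | length xs = length cs \<and> set xs \<subseteq> {0..<N}. word (zip xs (rotate1 xs)))"
    by (rule sum_PiE_list[OF assms, of "\<lambda>xs. word (zip xs (rotate1 xs))"])
  also have "\<dots> = casim N (length cs)"
    unfolding casim_def cycle_word
    using sum_PiE_list[of "[0..<length cs]" "\<lambda>xs. word (zip xs (rotate1 xs))" "{0..<N}"] by simp
  finally show ?thesis .
qed

text \<open>By \<open>diag\<close> the second components of each part are labels of that part, so
  each factor depends on its own indices only.\<close>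

lemma wdiag_append:
  assumes "set (map fst ps) \<inter> set (map fst qs) = {}" "diag ps" "diag qs"
  shows "wdiag N (ps @ qs) = wdiag N ps * wdiag N qs"
proof -
  let ?A = "set (map fst ps)" and ?B = "set (map fst qs)" and ?S = "{0..<N}"
  have "wdiag N ps * wdiag N qs = (\<Sum>(i, j)\<in>(?A \<rightarrow>\<^sub>E ?S) \<times> (?B \<rightarrow>\<^sub>E ?S).
      word (map (map_prod i i) ps @ map (map_prod j j) qs))"
    unfolding wdiag_def sum_product sum.cartesian_product word_append ..
  also have "\<dots> = (\<Sum>i\<in>(?A \<union> ?B) \<rightarrow>\<^sub>E ?S. word (map (map_prod i i) (ps @ qs)))"
  proof (rule sum.reindex_bij_witness[where i = "\<lambda>i. (restrict i ?A, restrict i ?B)"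
        and j = "\<lambda>(i, j). \<lambda>x. if x \<in> ?A then i x else j x"])
    fix i assume i: "i \<in> (?A \<union> ?B) \<rightarrow>\<^sub>E ?S"
    show "(case (restrict i ?A, restrict i ?B) of (i, j) \<Rightarrow> \<lambda>x. if x \<in> ?A then i x else j x) = i"
      using PiE_arb[OF i] by (auto simp: fun_eq_iff restrict_def)
    show "(restrict i ?A, restrict i ?B) \<in> (?A \<rightarrow>\<^sub>E ?S) \<times> (?B \<rightarrow>\<^sub>E ?S)"
      using PiE_mem[OF i] by auto
  next
    fix ij assume "ij \<in> (?A \<rightarrow>\<^sub>E ?S) \<times> (?B \<rightarrow>\<^sub>E ?S)"
    then obtain i j where ij: "ij = (i, j)" and i: "i \<in> ?A \<rightarrow>\<^sub>E ?S" and j: "j \<in> ?B \<rightarrow>\<^sub>E ?S" by auto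
    let ?m = "\<lambda>x. if x \<in> ?A then i x else j x"
    have "restrict ?m ?A = i"
      using PiE_arb[OF i] by (auto simp: fun_eq_iff restrict_def)
    moreover have "restrict ?m ?B = j"
    proof
      fix x
      show "restrict ?m ?B x = j x"
        using PiE_arb[OF j, of x] assms(1) by (cases "x \<in> ?B") (auto simp: restrict_def)
    qed
    ultimately show "(restrict (case ij of (i, j) \<Rightarrow> \<lambda>x. if x \<in> ?A then i x else j x) ?A,
       restrict (case ij of (i, j) \<Rightarrow> \<lambda>x. if x \<in> ?A then i x else j x) ?B) = ij"
      by (simp add: ij)
    show "(case ij of (i, j) \<Rightarrow> \<lambda>x. if x \<in> ?A then i x else j x) \<in> (?A \<union> ?B) \<rightarrow>\<^sub>E ?S"
      unfolding ij case_prod_conv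
    proof (rule PiE_I)
      fix x assume "x \<in> ?A \<union> ?B"
      then show "?m x \<in> ?S" using PiE_mem[OF i, of x] PiE_mem[OF j, of x] by (cases "x \<in> ?A") simp_all
    next
      fix x assume "x \<notin> ?A \<union> ?B"
      then show "?m x = undefined" using PiE_arb[OF j, of x] by simp
    qed
    have "map (map_prod ?m ?m) ps = map (map_prod i i) ps"
      using assms(2) unfolding diag_def by (intro map_map_prod_cong) auto
    moreover have "map (map_prod ?m ?m) qs = map (map_prod j j) qs"
      using assms(1,3) unfolding diag_def by (intro map_map_prod_cong) auto
    ultimately show "word (map (map_prod (case ij of (i, j) \<Rightarrow> \<lambda>x. if x \<in> ?A then i x else j x)
          (case ij of (i, j) \<Rightarrow> \<lambda>x. if x \<in> ?A then i x else j x)) (ps @ qs)) =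
        (case ij of (i, j) \<Rightarrow> word (map (map_prod i i) ps @ map (map_prod j j) qs))"
      by (simp only: ij case_prod_conv map_append)
  qed
  finally show ?thesis by (simp add: wdiag_def)
qed

text \<open>A maximal injective path closes up to a cycle.\<close>
lemma diag_has_cycle:
  assumes "diag ps" "ps \<noteq> []"
  obtains cs where "cs \<noteq> []" "distinct cs" "set (zip cs (rotate1 cs)) \<subseteq> set ps"
proof -
  define path where "path cs \<longleftrightarrow> cs \<noteq> [] \<and> distinct cs \<and> set cs \<subseteq> fst ` set ps \<and>
     (\<forall>k. Suc k < length cs \<longrightarrow> (cs ! k, cs ! Suc k) \<in> set ps)" for cs
  have inj: "inj_on snd (set ps)" and eq: "snd ` set ps = fst ` set ps" using assms by (auto simp: diag_alt)
  obtain a b where ab: "(a, b) \<in> set ps" using assms(2) by (cases ps) auto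
  then have "path [a]" by (force simp: path_def)
  moreover have "length cs < Suc (card (fst ` set ps))" if "path cs" for cs
    using that distinct_card[of cs] card_mono[of "fst ` set ps" "set cs"] by (auto simp: path_def)
  ultimately have "\<exists>cs. path cs \<and> (\<forall>ds. path ds \<longrightarrow> length ds \<le> length cs)"
    by (intro ex_has_greatest_nat) auto
  then obtain cs where cs: "path cs" and max: "\<And>ds. path ds \<Longrightarrow> length ds \<le> length cs"
    by (elim exE conjE) simp
  then have ne: "cs \<noteq> []" by (simp add: path_def)
  then have "last cs \<in> fst ` set ps" using cs by (auto simp: path_def)
  then obtain z where z: "(last cs, z) \<in> set ps" by force
  have zc: "z \<in> set cs"
  proof (rule ccontr)
    assume "z \<notin> set cs"
    moreover have "z \<in> fst ` set ps" using z eq by (force simp: image_iff)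
    moreover have "((cs @ [z]) ! k, (cs @ [z]) ! Suc k) \<in> set ps" if "k < length cs" for k
    proof (cases "Suc k < length cs")
      case True
      then show ?thesis using cs by (simp add: path_def nth_append)
    next
      case False
      then have "k = length cs - 1" "Suc k = length cs" using that by auto
      then show ?thesis using z ne by (simp add: nth_append last_conv_nth)
    qed
    ultimately have "path (cs @ [z])" using cs by (auto simp: path_def)
    from max[OF this] show False by simp
  qed
  then obtain k where k: "k < length cs" "z = cs ! k" by (auto simp: in_set_conv_nth)
  \<comment> \<open>If the path returned to a later vertex, the predecessor of that vertex and the
    end of the path would have the same image.\<close>
  have "k = 0"
  proof (rule ccontr)
    assume "k \<noteq> 0"
    then obtain l where l: "k = Suc l" by (cases k) auto
    then have "(cs ! l, z) \<in> set ps" using cs k by (simp add: path_def)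
    with z have "cs ! l = last cs" using inj by (force simp: inj_on_def)
    then have "cs ! l = cs ! (length cs - 1)" using ne by (simp add: last_conv_nth)
    moreover have "distinct cs" using cs by (simp add: path_def)
    ultimately have "l = length cs - 1" using k l by (subst (asm) nth_eq_iff_index_eq) auto
    with k l show False by simp
  qed
  then have hd: "(last cs, hd cs) \<in> set ps" using z k ne by (simp add: hd_conv_nth)
  have "set (zip cs (rotate1 cs)) \<subseteq> set ps"
  proof
    fix e assume "e \<in> set (zip cs (rotate1 cs))"
    then obtain j where j: "j < length cs" "e = (cs ! j, rotate1 cs ! j)" by (auto simp: set_zip)
    show "e \<in> set ps"
    proof (cases "Suc j < length cs")
      case True
      then have "rotate1 cs ! j = cs ! Suc j" by (simp add: nth_rotate1)
      then show ?thesis using cs j True by (simp add: path_def)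
    next
      case False
      then have "Suc j = length cs" using j by simp
      then have "rotate1 cs ! j = hd cs" "cs ! j = last cs"
        using ne j by (simp_all add: nth_rotate1 hd_conv_nth last_conv_nth flip: \<open>Suc j = length cs\<close>)
      then show ?thesis using hd j by simp
    qed
  qed
  with that[of cs] cs show thesis by (simp add: path_def)
qed

text \<open>Insertion by neighbouring transpositions; the prefix u carries the letters that are
  already in place.\<close>

lemma mset_eq_adjacent_swaps:
  assumes swap: "\<And>u x y v. P (u @ [x, y] @ v) \<Longrightarrow> P (u @ [y, x] @ v)"
    and "mset xs = mset ys" "P (u @ xs)"
  shows "P (u @ ys)"
  using assms(2,3)
proof (induction xs arbitrary: u ys)
  case Nil
  then show ?case by simp
next
  case (Cons x xs)
  then have "x \<in> set ys" by (metis list.set_intros(1) mset_eq_setD)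
  then obtain ys1 ys2 where ys: "ys = ys1 @ x # ys2" by (auto simp: in_set_conv_decomp)
  have "mset xs = mset (ys1 @ ys2)" using Cons.prems ys by simp
  from Cons.IH[OF this, of "u @ [x]"] Cons.prems have "P (u @ [x] @ ys1 @ ys2)" by simp
  moreover have "P (u @ [x] @ ys1 @ ys2) \<Longrightarrow> P (u @ ys1 @ [x] @ ys2)" for u
  proof (induction ys1 arbitrary: u)
    case (Cons y ys1)
    have "P ((u @ [y]) @ [x] @ ys1 @ ys2)" using swap[of u x y "ys1 @ ys2"] Cons.prems by simp
    from Cons.IH[OF this] show ?case by simp
  qed simp
  ultimately show ?case by (simp add: ys)
qed

text \<open>One polynomial has to serve all N. Swapping neighbours corrects it by two contractions,
  which are shorter and covered by induction on the length. For an order that starts with one full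
  cycle, the element factorises as a Casimir element times a shorter permutation word.\<close>

lemma ex_spec_wdiag: "diag ps \<Longrightarrow> \<exists>p. \<forall>N. spec N p \<approx>\<^bsub>N\<^esub> wdiag N ps"
proof (induction "length ps" arbitrary: ps rule: less_induct)
  case less
  define ex where "ex qs \<longleftrightarrow> (\<exists>p. \<forall>N. spec N p \<approx>\<^bsub>N\<^esub> wdiag N qs)" for qs
  define Q where "Q qs \<longleftrightarrow> diag qs \<and> length qs = length ps \<and> ex qs" for qs
  have exc: "\<exists>p. \<forall>N. spec N p \<approx>\<^bsub>N\<^esub> contr N u x y v"
    if d: "diag (u @ [x, y] @ v)" and l: "length (u @ [x, y] @ v) = length ps" for u x y v
  proof -
    have "length (merge u x y v) < length ps" using l by (simp add: merge_def)
    from less.hyps[OF this diag_merge(1)[OF d]]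
    obtain p where p: "\<And>N. spec N p \<approx>\<^bsub>N\<^esub> wdiag N (merge u x y v)" by auto
    show ?thesis
    proof (cases "snd x = fst y")
      case True
      have "spec N (pN * p) \<approx>\<^bsub>N\<^esub> contr N u x y v" for N
      proof -
        have "spec N (pN * p) \<approx>\<^bsub>N\<^esub> spec N pN * spec N p" by (rule spec_mult)
        also have "\<dots> \<approx>\<^bsub>N\<^esub> spec N pN * wdiag N (merge u x y v)" by (rule gl_cong_mult_left[OF p])
        also have "\<dots> = contr N u x y v" unfolding contr_eq[OF d] spec_pN if_P[OF True] ..
        finally show ?thesis .
      qed
      then show ?thesis by blast
    next
      case False
      have "spec N p \<approx>\<^bsub>N\<^esub> contr N u x y v" for N
        unfolding contr_eq[OF d] if_not_P[OF False] mult_1 by (rule p)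
      then show ?thesis by blast
    qed
  qed
  have swap: "Q (u @ [y, x] @ v)" if "Q (u @ [x, y] @ v)" for u x y v
  proof -
    have d: "diag (u @ [x, y] @ v)" and l: "length (u @ [x, y] @ v) = length ps"
      and "ex (u @ [x, y] @ v)" using that by (simp_all only: Q_def)
    then obtain p where p: "\<And>N. spec N p \<approx>\<^bsub>N\<^esub> wdiag N (u @ [x, y] @ v)" by (auto simp: ex_def)
    have d': "diag (u @ [y, x] @ v)" using d diag_mset[of "u @ [x, y] @ v" "u @ [y, x] @ v"] by simp
    have l': "length (u @ [y, x] @ v) = length ps" using l by simp
    obtain q where q: "\<And>N. spec N q \<approx>\<^bsub>N\<^esub> contr N u x y v" using exc[OF d l] by auto
    obtain r where r: "\<And>N. spec N r \<approx>\<^bsub>N\<^esub> contr N u y x v" using exc[OF d' l'] by auto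
    have "spec N (p - (q - r)) \<approx>\<^bsub>N\<^esub> wdiag N (u @ [y, x] @ v)" for N
    proof -
      have "spec N (p - (q - r)) \<approx>\<^bsub>N\<^esub> wdiag N (u @ [x, y] @ v) - (contr N u x y v - contr N u y x v)"
        unfolding spec_diff by (intro gl_cong_diff p q r)
      also have "\<dots> \<approx>\<^bsub>N\<^esub> wdiag N (u @ [x, y] @ v) - (wdiag N (u @ [x, y] @ v) - wdiag N (u @ [y, x] @ v))"
        by (intro gl_cong_diff gl_cong_refl gl_cong_sym[OF wdiag_swap] d)
      finally show ?thesis by simp
    qed
    then show ?thesis using d' l' by (auto simp: Q_def ex_def)
  qed
  show ?case
  proof (cases "ps = []")
    case True
    have "spec N 1 \<approx>\<^bsub>N\<^esub> wdiag N ps" for N by (simp add: True wdiag_def word_Nil)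
    then show ?thesis by blast
  next
    case False
    obtain cs where cs: "cs \<noteq> []" "distinct cs" "set (zip cs (rotate1 cs)) \<subseteq> set ps"
      using diag_has_cycle[OF less.prems False] .
    let ?c = "zip cs (rotate1 cs)"
    define rest where "rest = filter (\<lambda>e. e \<notin> set ?c) ps"
    have c1: "map fst ?c = cs" "map snd ?c = rotate1 cs" by simp_all
    have c2: "fst ` set ?c = set cs" "snd ` set ?c = set cs"
      by (simp_all only: set_map[symmetric] c1 set_rotate1)
    have dc: "diag ?c" unfolding diag_def c1 using cs by simp
    have P: "distinct ps" "inj_on fst (set ps)" "inj_on snd (set ps)" "snd ` set ps = fst ` set ps"
      using less.prems by (auto simp: diag_alt)
    have sr: "set rest = set ps - set ?c" by (auto simp: rest_def)
    have fr: "fst ` set rest = fst ` set ps - set cs"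
      unfolding sr inj_on_image_set_diff[OF P(2) Diff_subset cs(3)] c2 ..
    have dr: "diag rest"
    proof -
      have "snd ` set rest = snd ` set ps - set cs"
        unfolding sr inj_on_image_set_diff[OF P(3) Diff_subset cs(3)] c2 ..
      then show ?thesis
        using P fr by (auto simp: diag_alt rest_def intro: inj_on_subset)
    qed
    have m: "mset (?c @ rest) = mset ps"
      using dc dr P(1) cs(3) unfolding diag_alt
      by (subst set_eq_iff_mset_eq_distinct[symmetric]) (auto simp: sr)
    have "length rest < length ps"
    proof -
      have "length (?c @ rest) = length ps" using m by (metis size_mset)
      then have "length cs + length rest = length ps" by simp
      moreover have "length cs \<noteq> 0" using cs(1) by simp
      ultimately show ?thesis by linarith
    qed
    from less.hyps[OF this dr] obtain p where p: "\<And>N. spec N p \<approx>\<^bsub>N\<^esub> wdiag N rest" by auto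
    have "spec N (pvar (length cs) * p) \<approx>\<^bsub>N\<^esub> wdiag N (?c @ rest)" for N
    proof -
      have "spec N (pvar (length cs) * p) \<approx>\<^bsub>N\<^esub> spec N (pvar (length cs)) * spec N p" by (rule spec_mult)
      also have "\<dots> \<approx>\<^bsub>N\<^esub> spec N (pvar (length cs)) * wdiag N rest" by (rule gl_cong_mult_left[OF p])
      also have "spec N (pvar (length cs)) = wdiag N ?c"
        using cs by (simp add: wdiag_cycle spec_pvar Suc_le_eq)
      also have "wdiag N ?c * wdiag N rest = wdiag N (?c @ rest)"
        by (rule wdiag_append[symmetric]) (use dc dr fr c1 in auto)
      finally show ?thesis .
    qed
    then have "Q (?c @ rest)"
      using m diag_mset[OF m] less.prems mset_eq_length[OF m] by (auto simp: Q_def ex_def)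
    then have "Q ps" using mset_eq_adjacent_swaps[of Q "?c @ rest" ps "[]"] swap m by simp
    then show ?thesis by (simp add: Q_def ex_def)
  qed
qed

lemma ex_spec_wperm:
  assumes "\<alpha> permutes {0..<m}"
  shows "\<exists>p. \<forall>N. spec N p \<approx>\<^bsub>N\<^esub> wperm N m \<alpha>"
proof -
  let ?ps = "map (\<lambda>s. (s, \<alpha> s)) [0..<m]"
  have e: "map fst ?ps = [0..<m]" "map snd ?ps = map \<alpha> [0..<m]" by (simp_all add: comp_def)
  have "diag ?ps" unfolding diag_def e
    using permutes_inj_on[OF assms] permutes_image[OF assms] by (simp add: distinct_map)
  moreover have "wdiag N ?ps = wperm N m \<alpha>" for N
    by (simp add: wdiag_def wperm_def comp_def)
  ultimately show ?thesis using ex_spec_wdiag[of ?ps] by simp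
qed

section \<open>Uniqueness of the universal weight system\<close>

text \<open>Shuffle convolution of functionals on words, dual to the coproduct of the enveloping algebra.\<close>

primrec conv :: "'a list \<Rightarrow> ('a list \<Rightarrow> complex) \<Rightarrow> ('a list \<Rightarrow> complex) \<Rightarrow> complex" where
  "conv [] f g = f [] * g []"
| "conv (a # w) f g = conv w (\<lambda>u. f (a # u)) g + conv w f (\<lambda>u. g (a # u))"

lemma conv_zero: "conv w (\<lambda>_. 0) g = 0" "conv w f (\<lambda>_. 0) = 0"
  by (induction w arbitrary: f g) simp_all

lemma conv_add:
  "conv w (\<lambda>u. f u + f' u) g = conv w f g + conv w f' g"
  "conv w f (\<lambda>u. g u + g' u) = conv w f g + conv w f g'"
  by (induction w arbitrary: f f' g g') (simp_all add: algebra_simps)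

lemma conv_diff:
  "conv w (\<lambda>u. f u - f' u) g = conv w f g - conv w f' g"
  "conv w f (\<lambda>u. g u - g' u) = conv w f g - conv w f g'"
  by (induction w arbitrary: f f' g g') (simp_all add: algebra_simps)

lemma conv_if:
  "conv w (\<lambda>u. if P then f u else 0) g = (if P then conv w f g else 0)"
  "conv w f (\<lambda>u. if P then g u else 0) = (if P then conv w f g else 0)"
  by (simp_all add: conv_zero)

text \<open>The linear extension of such a functional annihilates the defining relations, so it
  descends to U(gl(N)); see \<open>app_rel_ideal\<close>.\<close>

definition rel_fun :: "nat \<Rightarrow> ((nat \<times> nat) list \<Rightarrow> complex) \<Rightarrow> bool" where
  "rel_fun N f \<longleftrightarrow> (\<forall>u v i j k l. i < N \<longrightarrow> j < N \<longrightarrow> k < N \<longrightarrow> l < N \<longrightarrow>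
     f (u @ (i, j) # (k, l) # v) = f (u @ (k, l) # (i, j) # v)
       + (if j = k then f (u @ (i, l) # v) else 0) - (if l = i then f (u @ (k, j) # v) else 0))"

lemma rel_fun_Cons: "rel_fun N f \<Longrightarrow> rel_fun N (\<lambda>u. f (a # u))"
  unfolding rel_fun_def by (metis append_Cons)

text \<open>Letters are primitive for the coproduct. When two neighbours go to different factors
  their order is immaterial and the terms cancel; when they go to the same factor, the relation for
  that factor applies.\<close>

lemma rel_fun_conv:
  assumes "rel_fun N f" "rel_fun N g"
  shows "rel_fun N (\<lambda>w. conv w f g)"
proof -
  have "conv (u @ (i, j) # (k, l) # v) f g = conv (u @ (k, l) # (i, j) # v) f g
       + (if j = k then conv (u @ (i, l) # v) f g else 0) - (if l = i then conv (u @ (k, j) # v) f g else 0)"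
    if lt: "i < N" "j < N" "k < N" "l < N" for u v i j k l
    using assms
  proof (induction u arbitrary: f g)
    case Nil
    have *: "(\<lambda>u. h ((i, j) # (k, l) # u)) = (\<lambda>u. h ((k, l) # (i, j) # u)
        + (if j = k then h ((i, l) # u) else 0) - (if l = i then h ((k, j) # u) else 0))"
      if "rel_fun N h" for h
    proof
      fix u
      show "h ((i, j) # (k, l) # u) = h ((k, l) # (i, j) # u)
        + (if j = k then h ((i, l) # u) else 0) - (if l = i then h ((k, j) # u) else 0)"
        using that[unfolded rel_fun_def, rule_format, OF lt, of "[]" u] by (simp only: append_Nil)
    qed
    show ?case
      by (simp only: append_Nil conv.simps *[OF Nil(1)] *[OF Nil(2)] conv_add conv_diff conv_if) auto
  next
    case (Cons a u)
    have 1: "rel_fun N (\<lambda>w. f (a # w))" "rel_fun N (\<lambda>w. g (a # w))"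
      using Cons.prems by (simp_all add: rel_fun_Cons)
    show ?case
      by (simp only: append_Cons conv.simps Cons.IH[OF 1(1) Cons.prems(2)] Cons.IH[OF Cons.prems(1) 1(2)]) auto
  qed
  then show ?thesis unfolding rel_fun_def by blast
qed

text \<open>Every split of a word shorter than e + d leaves a part too short for its functional. The
  bounds e - 1 and d - 1 in the induction stay valid when the subtraction is truncated at 0.\<close>

lemma conv_order:
  assumes "\<And>u. length u < e \<Longrightarrow> f u = 0" "\<And>u. length u < d \<Longrightarrow> g u = 0" "length w < e + d"
  shows "conv w f g = 0"
  using assms
proof (induction w arbitrary: f g e d)
  case Nil
  then show ?case by (cases "e = 0") auto
next
  case (Cons a w)
  have "conv w (\<lambda>u. f (a # u)) g = 0"
    using Cons.prems by (intro Cons.IH[of "e - 1" _ d]) auto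
  moreover have "conv w f (\<lambda>u. g (a # u)) = 0"
    using Cons.prems by (intro Cons.IH[of e _ "d - 1"]) auto
  ultimately show ?case by simp
qed

lemma conv_top_right:
  assumes "\<And>u. length u < length w \<Longrightarrow> g u = 0"
  shows "conv w f g = f [] * g w"
  using assms
proof (induction w arbitrary: g)
  case (Cons a w)
  have "conv w (\<lambda>u. f (a # u)) g = 0"
    using Cons.prems by (intro conv_order[of 0 _ "Suc (length w)"]) auto
  then show ?case using Cons.IH[of "\<lambda>u. g (a # u)"] Cons.prems by simp
qed simp

text \<open>Only splits that give a single letter to f survive; there are d + 1 of them, all with
  the same product.\<close>

lemma conv_top:
  assumes "f [] = 0" "\<And>u. length u < d \<Longrightarrow> g u = 0"
    "\<And>u. length u = d \<Longrightarrow> g u = c * prod_list (map (\<lambda>x. f [x]) u)" "length w = Suc d"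
  shows "conv w f g = of_nat (Suc d) * c * prod_list (map (\<lambda>x. f [x]) w)"
  using assms
proof (induction w arbitrary: g d c)
  case (Cons a w)
  have lw: "length w = d" using Cons.prems by simp
  have 1: "conv w (\<lambda>u. f (a # u)) g = f [a] * g w"
    using Cons.prems lw by (intro conv_top_right) auto
  have 2: "conv w f (\<lambda>u. g (a # u)) = of_nat d * c * f [a] * prod_list (map (\<lambda>x. f [x]) w)"
  proof (cases d)
    case 0
    then show ?thesis using lw Cons.prems(1) by simp
  next
    case (Suc e)
    have "conv w f (\<lambda>u. g (a # u)) = of_nat (Suc e) * (c * f [a]) * prod_list (map (\<lambda>x. f [x]) w)"
      using Cons.prems Suc lw by (intro Cons.IH) (auto simp: mult.assoc)
    then show ?thesis by (simp add: Suc mult.assoc)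
  qed
  show ?case using 1 2 Cons.prems lw by (simp add: algebra_simps)
qed simp

primrec conv_pow :: "nat \<Rightarrow> ('a list \<Rightarrow> complex) \<Rightarrow> 'a list \<Rightarrow> complex" where
  "conv_pow 0 f w = (if w = [] then 1 else 0)"
| "conv_pow (Suc d) f w = conv w f (conv_pow d f)"

lemma rel_fun_conv_pow: "rel_fun N f \<Longrightarrow> rel_fun N (conv_pow d f)"
proof (induction d)
  case 0
  show ?case by (simp add: rel_fun_def)
next
  case (Suc d)
  have "conv_pow (Suc d) f = (\<lambda>w. conv w f (conv_pow d f))" by (simp add: fun_eq_iff)
  then show ?case using Suc by (simp add: rel_fun_conv)
qed

text \<open>The convolution powers isolate the top symbol: this replaces the
  Poincare-Birkhoff-Witt theorem.\<close>
lemma conv_pow_top: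
  assumes "f [] = 0"
  shows "length w < d \<Longrightarrow> conv_pow d f w = 0"
    and "length w = d \<Longrightarrow> conv_pow d f w = fact d * prod_list (map (\<lambda>x. f [x]) w)"
proof (induction d arbitrary: w)
  case (Suc d)
  {
    case 1
    have "conv w f (conv_pow d f) = 0"
      using 1 assms Suc by (intro conv_order[of 1 _ d]) auto
    then show ?case by simp
  next
    case 2
    have "conv w f (conv_pow d f) = of_nat (Suc d) * fact d * prod_list (map (\<lambda>x. f [x]) w)"
      using 2 assms Suc by (intro conv_top) auto
    then show ?case by simp
  }
qed auto

section \<open>Weighted traces in the vector representation\<close>

primrec mat_entry :: "(nat \<times> nat) list \<Rightarrow> nat \<Rightarrow> nat \<Rightarrow> complex" where
  "mat_entry [] a b = (if a = b then 1 else 0)"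
| "mat_entry (x # w) a b = (if fst x = a then mat_entry w (snd x) b else 0)"

lemma mat_entry_mult:
  "mat_entry (u @ (i, j) # (k, l) # v) a b = (if j = k then mat_entry (u @ (i, l) # v) a b else 0)"
  by (induction u arbitrary: a) auto

text \<open>The functional w -> tr (diag(x) w) in the vector representation. Its value at the empty
  word is set to 0, as \<open>conv_pow_top\<close> requires; the relations contain no empty word, so
  it still respects them.\<close>

definition diag_tr :: "nat \<Rightarrow> (nat \<Rightarrow> complex) \<Rightarrow> (nat \<times> nat) list \<Rightarrow> complex" where
  "diag_tr N x w = (if w = [] then 0 else \<Sum>a<N. x a * mat_entry w a a)"

lemma rel_fun_diag_tr: "rel_fun N (diag_tr N x)"
proof -
  have "diag_tr N x (u @ (i, j) # (k, l) # v) = (if j = k then diag_tr N x (u @ (i, l) # v) else 0)" for u v i j k l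
    by (simp add: diag_tr_def mat_entry_mult)
  then show ?thesis by (simp add: rel_fun_def)
qed

lemma diag_tr_single: "diag_tr N x [(i, j)] = (if i = j \<and> i < N then x i else 0)"
  by (auto simp: diag_tr_def if_distrib[of "\<lambda>y. _ * y"] cong: if_cong)

definition app :: "((nat \<times> nat) list \<Rightarrow> complex) \<Rightarrow> nca \<Rightarrow> complex" where
  "app f a = (\<Sum>w\<in>Poly_Mapping.keys a. Poly_Mapping.lookup a w * f w)"

lemma app_add: "app f (a + b) = app f a + app f b"
  unfolding app_def by (rule setsum_keys_plus_distrib) (simp_all add: distrib_right)

lemma app_single: "app f (Poly_Mapping.single w c) = c * f w"
  unfolding app_def by simp

lemma app_0 [simp]: "app f 0 = 0"
  by (simp add: app_def)

lemma app_uminus: "app f (- a) = - app f a"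
  using app_add[of f a "- a"] by (simp add: eq_neg_iff_add_eq_0 add.commute)

lemma app_diff: "app f (a - b) = app f a - app f b"
  using app_add[of f a "- b"] by (simp add: app_uminus)

lemma app_sum: "app f (sum g A) = (\<Sum>x\<in>A. app f (g x))"
  by (induction A rule: infinite_finite_induct) (simp_all add: app_add)

lemma app_scal: "app f (scal c * a) = c * app f a"
  by (induction a rule: poly_mapping_induct_single) (simp_all add: mult_single app_single distrib_left app_add)

lemma app_rel_ideal:
  assumes "rel_fun N f" "a \<in> rel_ideal N"
  shows "app f a = 0"
  using assms(2)
proof (induction rule: rel_ideal.induct)
  case (gen i j k l c u v)
  have w: "word u * (EE i j * EE k l * word v) = word (u @ (i, j) # (k, l) # v)"
    "word u * (EE i j * word v) = word (u @ (i, j) # v)" for i j k l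
    by (simp_all add: mult_single plus_list_def)
  have "word u * (rel_elt i j k l * word v) =
     word (u @ (i, j) # (k, l) # v) - word (u @ (k, l) # (i, j) # v)
     - (if j = k then word (u @ (i, l) # v) else 0) + (if l = i then word (u @ (k, j) # v) else 0)"
    unfolding w[symmetric] rel_elt_def by (auto simp: algebra_simps)
  moreover have "app f (word (u @ (i, j) # (k, l) # v) - word (u @ (k, l) # (i, j) # v)
     - (if j = k then word (u @ (i, l) # v) else 0) + (if l = i then word (u @ (k, j) # v) else 0)) = 0"
    using assms(1)[unfolded rel_fun_def, rule_format, OF gen, of u v]
    by (auto simp: app_add app_diff app_single)
  ultimately show ?case by (simp add: app_scal)
qed (simp_all add: app_add)

section \<open>Homogeneous elements and their symbols\<close>

definition homog :: "nat \<Rightarrow> nca \<Rightarrow> bool" where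
  "homog d a \<longleftrightarrow> (\<forall>w\<in>Poly_Mapping.keys a. length w = d)"

lemma homog_0 [simp]: "homog d 0"
  by (simp add: homog_def)

lemma homog_scal: "homog 0 (scal c)"
  by (simp add: homog_def zero_list_def)

lemma homog_1: "homog 0 1"
  using homog_scal[of 1] by simp

lemma homog_EE: "homog 1 (EE i j)"
  by (simp add: homog_def)

lemma homog_add: "homog d a \<Longrightarrow> homog d b \<Longrightarrow> homog d (a + b)"
  using keys_add[of a b] by (auto simp: homog_def)

lemma homog_sum: "(\<And>x. x \<in> A \<Longrightarrow> homog d (f x)) \<Longrightarrow> homog d (sum f A)"
  by (induction A rule: infinite_finite_induct) (auto intro: homog_add)

lemma homog_mult: "homog d a \<Longrightarrow> homog e b \<Longrightarrow> homog (d + e) (a * b)"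
  using keys_mult[of a b] by (fastforce simp: homog_def plus_list_def)

lemma homog_power: "homog d a \<Longrightarrow> homog (d * n) (a ^ n)"
  by (induction n) (auto simp: homog_1 intro: homog_mult)

lemma homog_mpow: "homog p (mpow N p i j)"
proof (induction p arbitrary: i)
  case (Suc p)
  then show ?case using homog_mult[OF homog_EE] by (auto intro!: homog_sum)
qed (auto simp: homog_1)

lemma homog_casim: "k \<ge> 1 \<Longrightarrow> homog k (casim N k)"
  by (auto simp: casim_eq_trace intro: homog_sum homog_mpow)

lemma homog_cmon: "0 \<notin> set ks \<Longrightarrow> homog (\<Sum>k\<leftarrow>ks. k * e k) (cmon N e ks)"
  by (induction ks) (auto simp: homog_1 intro!: homog_mult homog_power homog_casim)

text \<open>The algebra homomorphism to the complex numbers that sends E_ij to t (i, j): the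
  commutative symbol, evaluated at the matrix t.\<close>

definition symb :: "(nat \<times> nat \<Rightarrow> complex) \<Rightarrow> nca \<Rightarrow> complex" where
  "symb t = app (\<lambda>w. prod_list (map t w))"

lemma symb_mult: "symb t (a * b) = symb t a * symb t b"
proof (induction a rule: poly_mapping_induct_single)
  case (single u c)
  show ?case
  proof (induction b rule: poly_mapping_induct_single)
    case (single v d)
    show ?case by (simp add: symb_def mult_single app_single plus_list_def)
  qed (simp_all add: symb_def app_add distrib_left)
qed (simp_all add: symb_def app_add distrib_right)

lemma symb_EE: "symb t (EE i j) = t (i, j)"
  by (simp add: symb_def app_single)

lemma symb_scal: "symb t (scal c) = c"
  by (simp add: symb_def app_single) (simp add: zero_list_def)

lemma symb_1 [simp]: "symb t 1 = 1"
  using symb_scal[of t 1] by simp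

lemma symb_sum: "symb t (sum f A) = (\<Sum>x\<in>A. symb t (f x))"
  by (simp add: symb_def app_sum)

lemma symb_power: "symb t (a ^ n) = symb t a ^ n"
  by (induction n) (simp_all add: symb_mult)

lemma symb_mpow:
  assumes "i < N" "\<And>i j. t (i, j) = (if i = j \<and> i < N then x i else 0)"
  shows "symb t (mpow N p i j) = (if i = j then x i ^ p else 0)"
  using assms(1)
proof (induction p arbitrary: i)
  case 0
  show ?case by (cases "i = j") (simp, simp add: symb_def)
next
  case (Suc p)
  have "symb t (mpow N (Suc p) i j) = x i * symb t (mpow N p i j)"
    using Suc.prems by (simp add: symb_sum symb_mult symb_EE assms(2) if_mult_0)
  then show ?case using Suc by simp
qed

lemma symb_casim:
  assumes "k \<ge> 1" "\<And>i j. t (i, j) = (if i = j \<and> i < N then x i else 0)"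
  shows "symb t (casim N k) = (\<Sum>i<N. x i ^ k)"
  using assms by (simp add: casim_eq_trace symb_sum symb_mpow)

lemma symb_cmon: "symb t (cmon N e ks) = (\<Prod>k\<leftarrow>ks. symb t (casim N k) ^ e k)"
  by (induction ks) (simp_all add: symb_mult symb_power)

lemma app_conv_pow_homog:
  assumes "f [] = 0" "homog d' a" "d' \<le> d"
  shows "app (conv_pow d f) a = (if d' = d then fact d * symb (\<lambda>x. f [x]) a else 0)"
proof -
  have "conv_pow d f w = (if d' = d then fact d * prod_list (map (\<lambda>x. f [x]) w) else 0)"
    if "w \<in> Poly_Mapping.keys a" for w
    using that assms conv_pow_top[of f w d] by (auto simp: homog_def)
  then have "app (conv_pow d f) a = (\<Sum>w\<in>Poly_Mapping.keys a. Poly_Mapping.lookup a w *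
      (if d' = d then fact d * prod_list (map (\<lambda>x. f [x]) w) else 0))"
    unfolding app_def by (intro sum.cong) auto
  then show ?thesis by (simp add: symb_def app_def sum_distrib_left mult_ac)
qed

text \<open>Weighted degree with C_k of degree k and N of degree 0; a specialised monomial is
  homogeneous of this degree. The top part may still contain N, so \<open>spec_unique_zero\<close>
  has to let N vary.\<close>

definition wt :: "(nat \<Rightarrow>\<^sub>0 nat) \<Rightarrow> nat" where
  "wt mo = (\<Sum>k\<leftarrow>sorted_list_of_set (Poly_Mapping.keys mo - {0}). k * Poly_Mapping.lookup mo k)"

text \<open>The d-th convolution power of \<open>diag_tr\<close> kills the ideal and all terms of
  weight below d. On weight d it is d! times the symbol, in which each C_k becomes a power
  sum.\<close>

lemma spec_zero_imp_symbol_zero: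
  assumes "spec N p \<approx>\<^bsub>N\<^esub> 0" "\<And>mo. mo \<in> Poly_Mapping.keys p \<Longrightarrow> wt mo \<le> d"
  shows "(\<Sum>mo\<in>{mo \<in> Poly_Mapping.keys p. wt mo = d}. Poly_Mapping.lookup p mo * of_nat N ^ Poly_Mapping.lookup mo 0 *
     (\<Prod>k\<in>Poly_Mapping.keys mo - {0}. (\<Sum>i<N. x i ^ k) ^ Poly_Mapping.lookup mo k)) = 0"
proof -
  let ?f = "diag_tr N x" and ?l = "Poly_Mapping.lookup"
  let ?ks = "\<lambda>mo. sorted_list_of_set (Poly_Mapping.keys mo - {0})"
  let ?S = "\<lambda>mo. \<Prod>k\<in>Poly_Mapping.keys mo - {0}. (\<Sum>i<N. x i ^ k) ^ ?l mo k"
  have f0: "?f [] = 0" by (simp add: diag_tr_def)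
  have "symb (\<lambda>x. ?f [x]) (cmon N (?l mo) (?ks mo)) = ?S mo" for mo
  proof -
    have "symb (\<lambda>x. ?f [x]) (cmon N (?l mo) (?ks mo)) = (\<Prod>k\<leftarrow>?ks mo. (\<Sum>i<N. x i ^ k) ^ ?l mo k)"
      unfolding symb_cmon
      by (intro arg_cong[where f = prod_list] map_cong refl)
         (subst symb_casim[where x = x], auto simp: diag_tr_single)
    also have "\<dots> = ?S mo" by (subst prod.distinct_set_conv_list[symmetric]) simp_all
    finally show ?thesis .
  qed
  moreover have "homog (wt mo) (cmon N (?l mo) (?ks mo))" for mo
    unfolding wt_def by (rule homog_cmon) simp
  ultimately have "app (conv_pow d ?f) (cmon N (?l mo) (?ks mo)) = (if wt mo = d then fact d * ?S mo else 0)"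
    if "mo \<in> Poly_Mapping.keys p" for mo
    using app_conv_pow_homog[of ?f "wt mo" "cmon N (?l mo) (?ks mo)" d, OF f0] assms(2)[OF that] by simp
  then have "app (conv_pow d ?f) (spec N p) =
      (\<Sum>mo\<in>Poly_Mapping.keys p. if wt mo = d then ?l p mo * of_nat N ^ ?l mo 0 * (fact d * ?S mo) else 0)"
    unfolding spec_def app_sum app_scal by (intro sum.cong) auto
  also have "\<dots> = fact d * (\<Sum>mo\<in>{mo \<in> Poly_Mapping.keys p. wt mo = d}. ?l p mo * of_nat N ^ ?l mo 0 * ?S mo)"
    by (subst sum.inter_filter[symmetric]) (simp_all add: sum_distrib_left mult_ac)
  finally show ?thesis
    using app_rel_ideal[OF rel_fun_conv_pow[OF rel_fun_diag_tr], of "spec N p" N d x] assms(1)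
    by (simp add: gl_cong_def)
qed

section \<open>Complex numbers with prescribed power sums\<close>

lemma sum_root_unity_power:
  assumes "m > 0" "0 < k" "k \<le> m"
  shows "(\<Sum>j<m. (z * cis (2 * pi / real m) ^ j) ^ k) = (if k = m then of_nat m * z ^ m else 0)"
proof -
  let ?w = "cis (2 * pi / real m)"
  have wm: "?w ^ m = 1" using assms by (simp add: DeMoivre)
  have "(\<Sum>j<m. (z * ?w ^ j) ^ k) = z ^ k * (\<Sum>j<m. (?w ^ k) ^ j)"
    by (simp add: sum_distrib_left power_mult_distrib mult.commute flip: power_mult)
  also have "\<dots> = (if k = m then of_nat m * z ^ m else 0)"
  proof (cases "k = m")
    case True
    then show ?thesis by (simp add: wm)
  next
    case False
    \<comment> \<open>As 0 < k < m, the ratio of the geometric sum is an m-th root of unity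
      different from 1.\<close>
    have "inj_on (\<lambda>k. cis (2 * pi * real k / real m)) {..<m}"
      using bij_betw_roots_unity[OF assms(1)] by (simp add: bij_betw_def)
    then have "cis (2 * pi * real k / real m) \<noteq> cis (2 * pi * real 0 / real m)"
      using inj_onD[of _ "{..<m}" k 0] assms False by fastforce
    then have "?w ^ k \<noteq> 1" by (simp add: DeMoivre mult_ac)
    then have "(\<Sum>j<m. (?w ^ k) ^ j) = ((?w ^ k) ^ m - 1) / (?w ^ k - 1)"
      by (rule geometric_sum)
    also have "(?w ^ k) ^ m = (?w ^ m) ^ k" by (simp add: mult.commute flip: power_mult)
    also have "\<dots> = 1" by (simp add: wm)
    finally show ?thesis using False by simp
  qed
  finally show ?thesis .
qed

text \<open>Adjoining z times all m-th roots of unity changes only the power sums of degree divisible by m.\<close>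
lemma power_sums_surj:
  "\<exists>x. \<forall>k\<in>{1..r}. (\<Sum>i<(\<Sum>k\<le>r. k). x i ^ k) = (s k :: complex)"
proof (induction r)
  case (Suc r)
  let ?n = "\<Sum>k\<le>r. k"
  obtain x where x: "\<And>k. k \<in> {1..r} \<Longrightarrow> (\<Sum>i<?n. x i ^ k) = s k" using Suc by blast
  let ?m = "Suc r"
  obtain z where z: "z ^ ?m = (s ?m - (\<Sum>i<?n. x i ^ ?m)) / of_nat ?m"
  proof (cases "(s ?m - (\<Sum>i<?n. x i ^ ?m)) / of_nat ?m = 0")
    case True
    then show ?thesis using that[of 0] by simp
  next
    case False
    then have "card {z. z ^ ?m = (s ?m - (\<Sum>i<?n. x i ^ ?m)) / of_nat ?m} = ?m"
      by (intro card_nth_roots) auto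
    then have "{z. z ^ ?m = (s ?m - (\<Sum>i<?n. x i ^ ?m)) / of_nat ?m} \<noteq> {}" by (metis card.empty nat.distinct(1))
    then show ?thesis using that by blast
  qed
  define y where "y i = (if i < ?n then x i else z * cis (2 * pi / real ?m) ^ (i - ?n))" for i
  have split: "(\<Sum>i<n + m. f i) = (\<Sum>i<n. f i) + (\<Sum>j<m. f (n + j))" for f :: "nat \<Rightarrow> complex" and n m
    by (induction m) simp_all
  have "(\<Sum>i<(\<Sum>k\<le>?m. k). y i ^ k) = s k" if k: "k \<in> {1..?m}" for k
  proof -
    have "(\<Sum>i<?n + ?m. y i ^ k) = (\<Sum>i<?n. y i ^ k) + (\<Sum>j<?m. y (?n + j) ^ k)"
      by (rule split)
    also have "(\<Sum>i<?n. y i ^ k) = (\<Sum>i<?n. x i ^ k)"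
      by (intro sum.cong) (auto simp: y_def)
    also have "(\<Sum>j<?m. y (?n + j) ^ k) = (\<Sum>j<?m. (z * cis (2 * pi / real ?m) ^ j) ^ k)"
      by (intro sum.cong) (auto simp: y_def)
    also have "\<dots> = (if k = ?m then of_nat ?m * z ^ ?m else 0)"
      using k by (intro sum_root_unity_power) auto
    finally have "(\<Sum>i<?n + ?m. y i ^ k) = (\<Sum>i<?n. x i ^ k) + (if k = ?m then of_nat ?m * z ^ ?m else 0)" .
    also have "\<dots> = s k"
    proof (cases "k = ?m")
      case True
      have "of_nat ?m * z ^ ?m = s ?m - (\<Sum>i<?n. x i ^ ?m)" unfolding z by (simp del: of_nat_Suc)
      then show ?thesis using True by simp
    next
      case False
      then show ?thesis using x[of k] k by simp
    qed
    finally show ?thesis by (simp add: add.commute)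
  qed
  then show ?case by blast
qed simp

text \<open>Padding by zeros leaves power sums of positive degree unchanged.\<close>

lemma power_sums_surj_large:
  assumes "N \<ge> (\<Sum>k\<le>r. k)"
  obtains x where "\<And>k. k \<in> {1..r} \<Longrightarrow> (\<Sum>i<N. x i ^ k) = (s k :: complex)"
proof -
  let ?n = "\<Sum>k\<le>r. k"
  obtain x where x: "\<And>k. k \<in> {1..r} \<Longrightarrow> (\<Sum>i<?n. x i ^ k) = s k" using power_sums_surj[of r s] by blast
  have "(\<Sum>i<N. (if i < ?n then x i else 0) ^ k) = s k" if "k \<in> {1..r}" for k
  proof -
    have "(\<Sum>i<N. (if i < ?n then x i else 0) ^ k) = (\<Sum>i<?n. x i ^ k)"
      using assms that by (intro sum.mono_neutral_cong_right) (auto simp: power_0_left)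
    then show ?thesis using x[OF that] by simp
  qed
  then show ?thesis using that[of "\<lambda>i. if i < ?n then x i else 0"] by blast
qed

lemma digits_unique:
  fixes a b :: "nat \<Rightarrow> nat"
  assumes "(\<Sum>k<n. a k * M ^ k) = (\<Sum>k<n. b k * M ^ k)" "\<And>k. a k < M" "\<And>k. b k < M" "k < n"
  shows "a k = b k"
  using assms
proof (induction n arbitrary: a b k)
  case (Suc n)
  have s: "(\<Sum>k<Suc n. c k * M ^ k) = c 0 + M * (\<Sum>k<n. c (Suc k) * M ^ k)" for c :: "nat \<Rightarrow> nat"
    by (simp add: sum.lessThan_Suc_shift sum_distrib_left mult_ac del: sum.lessThan_Suc)
  have eq: "a 0 + M * (\<Sum>k<n. a (Suc k) * M ^ k) = b 0 + M * (\<Sum>k<n. b (Suc k) * M ^ k)"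
    using Suc.prems(1) by (simp only: s)
  have "a 0 = b 0"
    using arg_cong[OF eq, of "\<lambda>t. t mod M"] Suc.prems(2,3)[of 0] by simp
  moreover have "M > 0" using Suc.prems(2)[of 0] by simp
  ultimately have e: "(\<Sum>k<n. a (Suc k) * M ^ k) = (\<Sum>k<n. b (Suc k) * M ^ k)" using eq by simp
  show ?case
  proof (cases k)
    case 0
    then show ?thesis using \<open>a 0 = b 0\<close> by simp
  next
    case (Suc l)
    then show ?thesis using Suc.IH[OF e, of l] Suc.prems by simp
  qed
qed simp

text \<open>Kronecker's substitution N = T, C_k = T^(M^k) separates monomials.\<close>
lemma spec_unique_zero:
  assumes "\<And>N. N \<ge> 1 \<Longrightarrow> spec N p \<approx>\<^bsub>N\<^esub> 0"
  shows "p = 0"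
proof (rule ccontr)
  assume "p \<noteq> 0"
  let ?K = "Poly_Mapping.keys p" and ?l = "Poly_Mapping.lookup"
  have ne: "?K \<noteq> {}" using \<open>p \<noteq> 0\<close> by simp
  define d where "d = Max (wt ` ?K)"
  have wd: "wt mo \<le> d" if "mo \<in> ?K" for mo using that by (simp add: d_def)
  define P where "P = {mo \<in> ?K. wt mo = d}"
  have finP: "finite P" by (simp add: P_def)
  have "d \<in> wt ` ?K" unfolding d_def using ne by (intro Max_in) auto
  then obtain mo0 where mo0: "mo0 \<in> P" by (auto simp: P_def)
  obtain r where r: "\<And>mo. mo \<in> ?K \<Longrightarrow> Poly_Mapping.keys mo \<subseteq> {..<r}"
  proof -
    have "finite (\<Union>mo\<in>?K. Poly_Mapping.keys mo)" by simp
    then obtain r where "\<forall>k\<in>(\<Union>mo\<in>?K. Poly_Mapping.keys mo). k < r"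
      using finite_nat_set_iff_bounded by auto
    then show ?thesis using that[of r] by auto
  qed
  obtain M where M: "\<And>mo k. mo \<in> ?K \<Longrightarrow> ?l mo k < M"
  proof -
    \<comment> \<open>The inserted 0 forces M > 0, which covers the variables of exponent 0.\<close>
    have "finite (insert 0 (\<Union>mo\<in>?K. ?l mo ` Poly_Mapping.keys mo))" by simp
    then obtain M where M: "\<forall>e\<in>insert 0 (\<Union>mo\<in>?K. ?l mo ` Poly_Mapping.keys mo). e < M"
      using finite_nat_set_iff_bounded by blast
    have "?l mo k < M" if "mo \<in> ?K" for mo k
    proof (cases "k \<in> Poly_Mapping.keys mo")
      case False
      then have "?l mo k = 0" by (simp add: in_keys_iff)
      then show ?thesis using M by simp
    qed (use M that in auto)
    then show ?thesis using that by blast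
  qed
  \<comment> \<open>Digits in base M. Position 0 holds the exponent of N, in accordance with N =
    T^(M^0).\<close>
  define code where "code mo = (\<Sum>k<r. ?l mo k * M ^ k)" for mo :: "nat \<Rightarrow>\<^sub>0 nat"
  have inj: "mo = mo'" if "mo \<in> ?K" "mo' \<in> ?K" "code mo = code mo'" for mo mo'
  proof (rule poly_mapping_eqI)
    fix k
    show "?l mo k = ?l mo' k"
    proof (cases "k < r")
      case True
      then show ?thesis
        using digits_unique[of "?l mo" M r "?l mo'" k] that M by (simp add: code_def)
    next
      case False
      then have "k \<notin> Poly_Mapping.keys mo" "k \<notin> Poly_Mapping.keys mo'" using r that by auto
      then show ?thesis by (simp add: in_keys_iff)
    qed
  qed
  define q where "q = (\<Sum>mo\<in>P. monom (?l p mo) (code mo))"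
  let ?n0 = "\<Sum>k\<le>r. k"
  \<comment> \<open>T is both the value of N and the number of the x_i, so the power sums are
    prescribed for large T only; these are still infinitely many roots of q.\<close>
  have root: "poly q (of_nat T) = 0" if T: "T \<ge> Suc ?n0" for T
  proof -
    obtain x where x: "\<And>k. k \<in> {1..r} \<Longrightarrow> (\<Sum>i<T. x i ^ k) = (of_nat T ^ (M ^ k) :: complex)"
      using power_sums_surj_large[of r T "\<lambda>k. of_nat T ^ (M ^ k)"] T by auto
    have "of_nat T ^ ?l mo 0 * (\<Prod>k\<in>Poly_Mapping.keys mo - {0}. (\<Sum>i<T. x i ^ k) ^ ?l mo k) =
        (of_nat T ^ code mo :: complex)" if mo: "mo \<in> P" for mo
    proof -
      have K: "Poly_Mapping.keys mo \<subseteq> {..<r}" using r mo by (auto simp: P_def)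
      have "(\<Prod>k\<in>Poly_Mapping.keys mo - {0}. (\<Sum>i<T. x i ^ k) ^ ?l mo k) =
          (\<Prod>k\<in>Poly_Mapping.keys mo - {0}. (of_nat T ^ (M ^ k)) ^ ?l mo k :: complex)"
        using K by (intro prod.cong refl, subst x) auto
      then have "of_nat T ^ ?l mo 0 * (\<Prod>k\<in>Poly_Mapping.keys mo - {0}. (\<Sum>i<T. x i ^ k) ^ ?l mo k) =
          (\<Prod>k\<in>insert 0 (Poly_Mapping.keys mo - {0}). (of_nat T ^ (M ^ k)) ^ ?l mo k :: complex)"
        by (subst prod.insert) simp_all
      also have "\<dots> = (\<Prod>k\<in>Poly_Mapping.keys mo. (of_nat T ^ (M ^ k)) ^ ?l mo k)"
        by (rule prod_keys_superset[symmetric]) auto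
      also have "\<dots> = (\<Prod>k<r. (of_nat T ^ (M ^ k)) ^ ?l mo k)"
        using K by (intro prod_keys_superset) auto
      also have "\<dots> = of_nat T ^ code mo"
        by (simp add: code_def power_sum mult.commute flip: power_mult)
      finally show ?thesis .
    qed
    then have "poly q (of_nat T) = (\<Sum>mo\<in>P. ?l p mo * of_nat T ^ ?l mo 0 *
        (\<Prod>k\<in>Poly_Mapping.keys mo - {0}. (\<Sum>i<T. x i ^ k) ^ ?l mo k))"
      by (simp add: q_def poly_sum poly_monom mult.assoc)
    also have "\<dots> = 0"
      unfolding P_def using T by (intro spec_zero_imp_symbol_zero assms wd) auto
    finally show ?thesis .
  qed
  have "infinite ((of_nat :: nat \<Rightarrow> complex) ` {Suc ?n0..})"
    using infinite_Ici[of "Suc ?n0"] by (auto dest!: finite_imageD simp: inj_on_def)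
  moreover have "(of_nat :: nat \<Rightarrow> complex) ` {Suc ?n0..} \<subseteq> {t. poly q t = 0}"
    using root by auto
  ultimately have "infinite {t. poly q t = 0}" using finite_subset by blast
  then have "q = 0" using poly_roots_finite by blast
  moreover have "coeff q (code mo0) = ?l p mo0"
  proof -
    have "coeff q (code mo0) = (\<Sum>mo\<in>P. if mo = mo0 then ?l p mo else 0)"
      unfolding q_def coeff_sum
      using inj mo0 by (intro sum.cong refl) (auto simp: P_def)
    then show ?thesis using mo0 finP by simp
  qed
  ultimately show False using mo0 by (simp add: P_def in_keys_iff)
qed

lemma spec_unique:
  assumes "\<And>N. N \<ge> 1 \<Longrightarrow> spec N p \<approx>\<^bsub>N\<^esub> spec N q"
  shows "p = q"
proof -
  have "p - q = 0"
    using assms by (intro spec_unique_zero) (simp add: gl_cong_def spec_diff)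
  then show ?thesis by simp
qed

text \<open>Existence and uniqueness together justify the definite description in
  \<open>w_gl\<close>.\<close>

lemma w_gl_spec:
  assumes "\<alpha> permutes {0..<m}" "N \<ge> 1"
  shows "spec N (w_gl m \<alpha>) \<approx>\<^bsub>N\<^esub> wperm N m \<alpha>"
proof -
  have *: "U_eq N (specialize N p) (w_glN N m \<alpha>) \<longleftrightarrow> spec N p \<approx>\<^bsub>N\<^esub> wperm N m \<alpha>" for N p
    unfolding lookup_spec[symmetric] lookup_wperm[symmetric] by (rule U_eq_iff)
  obtain p where p: "\<And>N. spec N p \<approx>\<^bsub>N\<^esub> wperm N m \<alpha>" using ex_spec_wperm[OF assms(1)] by auto
  have "q = p" if q: "\<forall>N\<ge>1. spec N q \<approx>\<^bsub>N\<^esub> wperm N m \<alpha>" for q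
    using q gl_cong_trans[OF _ gl_cong_sym[OF p]] by (intro spec_unique) blast
  then have "w_gl m \<alpha> = p" unfolding w_gl_def * using p by (intro the_equality) auto
  then show ?thesis using p by simp
qed

theorem theorem5:
  fixes m :: nat and \<alpha> :: "nat \<Rightarrow> nat"
  assumes "\<alpha> permutes {0..<m}"
  shows "schur_subst (w_gl m (inv \<alpha>)) = (-1) ^ m * sign_flip (schur_subst (w_gl m \<alpha>))"
proof -
  have sgn: "spec N ((-1) ^ m * p) = (-1) ^ m * spec N p" for N p
    by (cases "even m") (simp_all add: minus_one_power_iff spec_uminus)
  \<comment> \<open>An equation in C[N,C_1,...] and not just a family of congruences, so the Schur
    substitution can be applied to both sides.\<close>
  have "w_gl m (inv \<alpha>) = (-1) ^ m * psubst dual_img (w_gl m \<alpha>)"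
  proof (rule spec_unique)
    fix N :: nat assume N: "N \<ge> 1"
    have "spec N (w_gl m (inv \<alpha>)) \<approx>\<^bsub>N\<^esub> wperm N m (inv \<alpha>)"
      by (rule w_gl_spec[OF permutes_inv[OF assms] N])
    also have "\<dots> = (-1) ^ m * theta (wperm N m \<alpha>)"
      unfolding theta_wperm[OF assms] by (simp add: mult.assoc[symmetric] flip: power_add mult_2)
    also have "\<dots> \<approx>\<^bsub>N\<^esub> (-1) ^ m * theta (spec N (w_gl m \<alpha>))"
      by (intro gl_cong_mult_left theta_cong gl_cong_sym[OF w_gl_spec[OF assms N]])
    also have "\<dots> \<approx>\<^bsub>N\<^esub> (-1) ^ m * spec N (psubst dual_img (w_gl m \<alpha>))"
      by (intro gl_cong_mult_left theta_spec)
    also have "\<dots> = spec N ((-1) ^ m * psubst dual_img (w_gl m \<alpha>))" by (simp only: sgn)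
    finally show "spec N (w_gl m (inv \<alpha>)) \<approx>\<^bsub>N\<^esub> spec N ((-1) ^ m * psubst dual_img (w_gl m \<alpha>))" .
  qed
  then have "schur_subst (w_gl m (inv \<alpha>)) = (-1) ^ m * schur_subst (psubst dual_img (w_gl m \<alpha>))"
    by (simp add: schur_subst_def psubst_mult psubst_power psubst_uminus)
  then show ?thesis by (simp only: schur_subst_dual)
qed

end
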